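(* Let $(N,g)$ be a rotationally symmetric riemannian two-manifold and $\mathbb{G}$ be the associated neutral Kähler metric on $TN$. A rotationally symmetric surface which is given by the graph of a local section $\xi\mapsto(\xi,\eta=F(\xi,\bar\xi))$ is area-stationary with respect to $\mathbb{G}$ if and only if $$F=\left[A_1R+B_1R^{-1}e^{-2u}\pm i\left[A_2R^2+B_2e^{-2u}-B_1^2R^{-2}e^{-4u}\right]^{\frac12}\right]e^{i\theta}$$ for some $A_1,A_2,B_1,B_2\in\mathbb{R}$ with $A_2\neq0$, where $\xi=Re^{i\theta}$ and $g=e^{2u}d\xi d\bar\xi$ for $u=u(R)$.
   Context: The metric $g$ is rotationally symmetric if there is a conformal coordinate $\xi$ with $g=e^{2u}d\xi d\bar\xi$ and $u=u(|\xi|)$. Coordinates $(\xi,\eta)$ on $TN$ are given by identifying $(\xi,\eta)$ with $\eta\frac{\partial}{\partial\xi}+\bar\eta\frac{\partial}{\partial\bar\xi}\in T_\xi N$. The neutral Kähler metric on $TN$ is $\mathbb{G}=2\,\mathrm{Im}\left(e^{2u}d\bar\eta\, d\xi-\eta\,\partial(e^{2u})\,d\xi d\bar\xi\right)$, with $\partial=\partial/\partial\xi$, $\bar\partial=\partial/\partial\bar\xi$. A surface in $TN$ is rotationally symmetric if it is invariant under the isometries $(\xi,\eta)\mapsto(\xi e^{iC},\eta e^{iC})$, $C\in\mathbb{R}$; for a graph this means $F=G(R)e^{i\theta}$ for a complex-valued function $G$. The local section is smooth, defined over a connected rotationally invariant open set (an annulus $R\in I$, $I\subset(0,\infty)$ an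 interval), and the square root in the formula is that of a nonnegative real function, so that $F=(H\pm i\Psi^{1/2})e^{i\theta}$ with $H=H(R)$, $\Psi=\Psi(R)\ge 0$ real. For a graph put $\sigma=-\partial\bar F$, $\rho=e^{-2u}\partial(Fe^{2u})$, $\lambda=\mathrm{Im}\,\rho$. The induced metric is $e^{2u}(i\sigma\,d\xi^2-2\lambda\,d\xi d\bar\xi-i\bar\sigma\,d\bar\xi^2)$, degenerate exactly where $\lambda^2=\sigma\bar\sigma$, and (up to a constant factor) the area functional is $A(F)=\int|\lambda^2-\sigma\bar\sigma|^{1/2}e^{2u}\,d\xi d\bar\xi$. The graph is area-stationary if $\delta A(F)=0$ for all smooth compactly supported variations $\delta F$, equivalently if $$i\,\partial\left(\frac{\lambda}{\sqrt{|\lambda^2-\sigma\bar\sigma|}}\right)-e^{-2u}\,\bar\partial\left(\frac{\sigma e^{2u}}{\sqrt{|\lambda^2-\sigma\bar\sigma|}}\right)=0 .$$ Throughout, the graphs considered have nondegenerate induced metric ($\lambda^2\neq\sigma\bar\sigma$), so that these expressions make sense.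
   Formalization: It is assumed in addition that R²e^{2u} is not constant on the annulus; if it is constant (flat cylinder), every nondegenerate rotationally symmetric graph is area-stationary but none has the stated form, e.g. F=R²e^{iθ} with e^{2u}=R^{-2}. *)

theory Defs
  imports "HOL-Analysis.Analysis"
begin

section \<open>Smooth maps on open sets\<close>

fun Ck_on :: "nat \<Rightarrow> 'a::real_normed_vector set \<Rightarrow> ('a \<Rightarrow> 'b::real_normed_vector) \<Rightarrow> bool" where
  "Ck_on 0 S f \<longleftrightarrow> continuous_on S f"
| "Ck_on (Suc k) S f \<longleftrightarrow>
     (\<forall>x\<in>S. f differentiable (at x)) \<and> (\<forall>v. Ck_on k S (\<lambda>x. frechet_derivative f (at x) v))"

definition smooth_on :: "'a::real_normed_vector set \<Rightarrow> ('a \<Rightarrow> 'b::real_normed_vector) \<Rightarrow> bool" where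
  "smooth_on S f \<longleftrightarrow> (\<forall>k. Ck_on k S f)"

section \<open>The neutral Kaehler metric on the tangent bundle\<close>

text \<open>
  Everything takes place in a conformal coordinate \<open>\<xi>\<close> on the surface, with metric
  \<open>g = e\<^sup>2\<^sup>U d\<xi> d\<xi>\<^sup>*\<close> (the star denotes complex conjugation), where
  \<open>U :: complex \<Rightarrow> real\<close>.  A point of the tangent bundle is a pair \<open>(\<xi>, \<eta>)\<close>, and a tangent
  vector there is the pair of its components \<open>(d\<xi>, d\<eta>)\<close>.
\<close>

definition wirt :: "(complex \<Rightarrow> complex) \<Rightarrow> complex \<Rightarrow> complex" where
  "wirt f z = (frechet_derivative f (at z) 1 - \<i> * frechet_derivative f (at z) \<i>) / 2"

text \<open>
  The symmetric bilinear form whose quadratic form is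
  \<open>2 Im (e\<^sup>2\<^sup>U d\<eta>\<^sup>* d\<xi> - \<eta> \<partial>(e\<^sup>2\<^sup>U) d\<xi> d\<xi>\<^sup>*)\<close>; a product of two one-forms stands for
  the symmetrised product, so the factor 2 cancels in the polarisation.
\<close>

definition neutral_metric ::
  "(complex \<Rightarrow> real) \<Rightarrow> complex \<times> complex \<Rightarrow> complex \<times> complex \<Rightarrow> complex \<times> complex \<Rightarrow> real" where
  "neutral_metric U p X Y =
     Im (of_real (exp (2 * U (fst p))) * (cnj (snd X) * fst Y + cnj (snd Y) * fst X)
       - snd p * wirt (\<lambda>z. of_real (exp (2 * U z))) (fst p)
           * (fst X * cnj (fst Y) + fst Y * cnj (fst X)))"

section \<open>Graphs of local sections\<close>

definition graph_over :: "complex set \<Rightarrow> (complex \<Rightarrow> complex) \<Rightarrow> (complex \<times> complex) set" where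
  "graph_over \<Omega> F = {(\<xi>, F \<xi>) |\<xi>. \<xi> \<in> \<Omega>}"

definition rot_symmetric_surface :: "(complex \<times> complex) set \<Rightarrow> bool" where
  "rot_symmetric_surface S \<longleftrightarrow> (\<forall>C::real. (\<lambda>(\<xi>, \<eta>). (\<xi> * cis C, \<eta> * cis C)) ` S = S)"

definition induced_metric ::
  "(complex \<Rightarrow> real) \<Rightarrow> (complex \<Rightarrow> complex) \<Rightarrow> complex \<Rightarrow> complex \<Rightarrow> complex \<Rightarrow> real" where
  "induced_metric U F \<xi> v w =
     neutral_metric U (\<xi>, F \<xi>)
       (v, frechet_derivative F (at \<xi>) v) (w, frechet_derivative F (at \<xi>) w)"

definition nondegenerate_form :: "(complex \<Rightarrow> complex \<Rightarrow> real) \<Rightarrow> bool" where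
  "nondegenerate_form b \<longleftrightarrow> (\<forall>v. (\<forall>w. b v w = 0) \<longrightarrow> v = 0)"

text \<open>Determinant of the Gram matrix in the real coordinate basis \<open>1, \<i>\<close>.\<close>

definition gram_det :: "(complex \<Rightarrow> complex \<Rightarrow> real) \<Rightarrow> real" where
  "gram_det b = b 1 1 * b \<i> \<i> - b 1 \<i> * b \<i> 1"

definition graph_area ::
  "(complex \<Rightarrow> real) \<Rightarrow> complex set \<Rightarrow> (complex \<Rightarrow> complex) \<Rightarrow> real" where
  "graph_area U K F = integral K (\<lambda>\<xi>. sqrt \<bar>gram_det (induced_metric U F \<xi>)\<bar>)"

text \<open>
  The area of the whole graph may be infinite; the first variation is therefore taken over a
  compact set outside of which the variation vanishes.
\<close>

definition area_stationary ::
  "(complex \<Rightarrow> real) \<Rightarrow> complex set \<Rightarrow> (complex \<Rightarrow> complex) \<Rightarrow> bool" where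
  "area_stationary U \<Omega> F \<longleftrightarrow>
     (\<forall>K \<phi>. compact K \<and> K \<subseteq> \<Omega> \<and> smooth_on UNIV \<phi> \<and> (\<forall>z. z \<notin> K \<longrightarrow> \<phi> z = 0) \<longrightarrow>
        ((\<lambda>t. graph_area U K (\<lambda>z. F z + of_real t * \<phi> z)) has_real_derivative 0) (at 0))"

section \<open>The coefficients sigma and lambda of the induced metric\<close>

definition sigma :: "(complex \<Rightarrow> complex) \<Rightarrow> complex \<Rightarrow> complex" where
  "sigma F \<xi> = - wirt (\<lambda>z. cnj (F z)) \<xi>"

definition lambda :: "(complex \<Rightarrow> real) \<Rightarrow> (complex \<Rightarrow> complex) \<Rightarrow> complex \<Rightarrow> real" where
  "lambda U F \<xi> =
     Im (of_real (exp (- 2 * U \<xi>)) * wirt (\<lambda>z. F z * of_real (exp (2 * U z))) \<xi>)"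

lemma fderiv_split:
  assumes "F differentiable (at \<xi>)"
  shows "frechet_derivative F (at \<xi>) v
    = of_real (Re v) * frechet_derivative F (at \<xi>) 1 + of_real (Im v) * frechet_derivative F (at \<xi>) \<i>"
proof -
  interpret linear "frechet_derivative F (at \<xi>)"
    using assms by (rule linear_frechet_derivative)
  have "v = Re v *\<^sub>R 1 + Im v *\<^sub>R \<i>"
    by (simp add: complex_eq_iff)
  then have "frechet_derivative F (at \<xi>) v = frechet_derivative F (at \<xi>) (Re v *\<^sub>R 1 + Im v *\<^sub>R \<i>)"
    by simp
  then show ?thesis
    by (simp only: add scale) (simp add: scaleR_conv_of_real)
qed

lemma wirt_factor:
  assumes U: "U differentiable (at \<xi>)"
  shows "wirt (\<lambda>z. of_real (exp (2 * U z))) \<xi>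
    = of_real (exp (2 * U \<xi>)) *
        (of_real (frechet_derivative U (at \<xi>) 1) - \<i> * of_real (frechet_derivative U (at \<xi>) \<i>))"
proof -
  have "(U has_derivative frechet_derivative U (at \<xi>)) (at \<xi>)"
    using U by (simp add: frechet_derivative_works)
  then have "((\<lambda>z. of_real (exp (2 * U z)) :: complex) has_derivative
      (\<lambda>v. of_real (exp (2 * U \<xi>) * (2 * frechet_derivative U (at \<xi>) v)))) (at \<xi>)"
    by (auto intro!: derivative_eq_intros simp: algebra_simps)
  from frechet_derivative_at[OF this, symmetric] show ?thesis
    by (simp add: wirt_def field_simps)
qed

lemma sigma_eq:
  assumes F: "F differentiable (at \<xi>)"
  shows "sigma F \<xi>
    = - (cnj (frechet_derivative F (at \<xi>) 1) - \<i> * cnj (frechet_derivative F (at \<xi>) \<i>)) / 2"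
proof -
  have "(F has_derivative frechet_derivative F (at \<xi>)) (at \<xi>)"
    using F by (simp add: frechet_derivative_works)
  then have "((\<lambda>z. cnj (F z)) has_derivative (\<lambda>v. cnj (frechet_derivative F (at \<xi>) v))) (at \<xi>)"
    by (auto intro!: derivative_eq_intros)
  from frechet_derivative_at[OF this, symmetric] show ?thesis
    by (simp add: sigma_def wirt_def field_simps)
qed

lemma lambda_eq:
  assumes F: "F differentiable (at \<xi>)" and U: "U differentiable (at \<xi>)"
  shows "lambda U F \<xi> = Im (wirt F \<xi> + F \<xi> *
    (of_real (frechet_derivative U (at \<xi>) 1) - \<i> * of_real (frechet_derivative U (at \<xi>) \<i>)))"
proof -
  let ?D = "frechet_derivative F (at \<xi>)" and ?T = "frechet_derivative U (at \<xi>)"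
  have "(F has_derivative ?D) (at \<xi>)" "(U has_derivative ?T) (at \<xi>)"
    using F U by (simp_all add: frechet_derivative_works)
  then have "((\<lambda>z. F z * of_real (exp (2 * U z))) has_derivative
      (\<lambda>v. of_real (exp (2 * U \<xi>)) * (?D v + 2 * F \<xi> * of_real (?T v)))) (at \<xi>)"
    by (auto intro!: derivative_eq_intros simp: algebra_simps)
  from frechet_derivative_at[OF this, symmetric]
  have "wirt (\<lambda>z. F z * of_real (exp (2 * U z))) \<xi> = of_real (exp (2 * U \<xi>)) *
      (wirt F \<xi> + F \<xi> * (of_real (?T 1) - \<i> * of_real (?T \<i>)))"
    by (simp add: wirt_def field_simps)
  moreover have "of_real (exp (- 2 * U \<xi>)) * (of_real (exp (2 * U \<xi>)) * w) = w" for w :: complex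
    by (simp add: mult.assoc[symmetric] of_real_mult[symmetric] exp_add[symmetric] del: of_real_mult)
  ultimately show ?thesis
    by (simp only: lambda_def)
qed

lemma induced_metric_polar:
  assumes F: "F differentiable (at \<xi>)" and U: "U differentiable (at \<xi>)"
  shows "induced_metric U F \<xi> v w =
    - 2 * exp (2 * U \<xi>) * (Im (sigma F \<xi> * v * w) + lambda U F \<xi> * Re (v * cnj w))"
proof -
  have "Im (of_real e * (cnj (of_real (Re v) * a + of_real (Im v) * b) * w
          + cnj (of_real (Re w) * a + of_real (Im w) * b) * v)
        - f * (of_real e * (of_real s - \<i> * of_real t)) * (v * cnj w + w * cnj v))
    = - 2 * e * (Im (- (cnj a - \<i> * cnj b) / 2 * v * w)
        + Im ((a - \<i> * b) / 2 + f * (of_real s - \<i> * of_real t)) * Re (v * cnj w))"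
    for a b f :: complex and e s t :: real
    by simp (simp add: add_divide_distrib diff_divide_distrib ring_distribs)
  then show ?thesis
    unfolding induced_metric_def neutral_metric_def fst_conv snd_conv
      sigma_eq[OF F] lambda_eq[OF F U] wirt_factor[OF U]
      fderiv_split[OF F, of v] fderiv_split[OF F, of w] wirt_def[of F] .
qed

lemma induced_metric_eq:
  assumes "F differentiable (at \<xi>)" and "U differentiable (at \<xi>)"
  shows "of_real (induced_metric U F \<xi> v v) =
    of_real (exp (2 * U \<xi>)) *
      (\<i> * sigma F \<xi> * v^2 - 2 * of_real (lambda U F \<xi>) * v * cnj v - \<i> * cnj (sigma F \<xi>) * cnj v ^ 2)"
  unfolding induced_metric_polar[OF assms]
  by (simp add: complex_eq_iff power2_eq_square algebra_simps)

lemma gram_det_induced_metric: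
  assumes "F differentiable (at \<xi>)" and "U differentiable (at \<xi>)"
  shows "gram_det (induced_metric U F \<xi>) =
    4 * exp (2 * U \<xi>) ^ 2 * ((lambda U F \<xi>)^2 - (cmod (sigma F \<xi>))^2)"
  unfolding gram_det_def induced_metric_polar[OF assms] cmod_power2
  by (simp add: power2_eq_square algebra_simps)

section \<open>Rotationally symmetric data\<close>

definition annulus :: "real set \<Rightarrow> complex set" where
  "annulus I = {\<xi>. cmod \<xi> \<in> I}"

end

theory Submission
  imports Defs
begin

text \<open>
  Write \<open>F = \<xi> (h + i p)\<close> with \<open>h, p\<close> real functions of \<open>R = \<bar>\<xi>\<bar>\<close>, and put \<open>w = R\<^sup>2 e\<^sup>2\<^sup>u\<close>.  In these
  variables \<open>4 (\<lambda>\<^sup>2 - \<bar>\<sigma>\<bar>\<^sup>2) = R\<^sup>2 S / w\<^sup>2\<close> with \<open>S = w' (w p\<^sup>2)' - (w h')\<^sup>2\<close>, so up to constant factors the area of the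
  graph is \<open>\<integral> \<surd>\<bar>S\<bar> dR\<close>.  Nondegeneracy makes \<open>S\<close> nowhere zero, so its sign \<open>s\<close> is constant and
  \<open>L = \<surd>(s S)\<close> is smooth.  The integrand depends on \<open>h\<close> only through \<open>h'\<close>, and on \<open>p\<close> only through
  the derivative of \<open>y = w p\<^sup>2\<close>; the corresponding momenta are, up to constants,
  \<open>\<kappa> = w\<^sup>2 h' / L\<close> and \<open>M = w' / L\<close>.  A variation of \<open>p\<close> changes \<open>y\<close> by \<open>2 w p \<delta>p\<close>, so the Euler-Lagrange
  equations are \<open>\<kappa>' = 0\<close> and \<open>p M' = 0\<close>.

  Stationarity concerns all compactly supported variations, not only the rotationally symmetric ones.
  The lemma \<open>first_variation_of_area\<close> differentiates under the integral and integrates by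
  parts in the plane: the first variation is the integral of \<open>2 Re (\<Gamma> \<phi>)\<close>.  For rotationally
  symmetric graphs \<open>euler_lagrange\<close> finds
  \<open>\<Gamma> = s (\<kappa>' + i w p M') / (2 R \<xi>)\<close>, and the fundamental lemma of the calculus of
  variations, with smooth bump functions as test variations, turns stationarity into the two equations.

  The equations integrate explicitly.  If \<open>M' \<noteq> 0\<close> at some point, then \<open>p = 0\<close> nearby, and constancy
  of \<open>\<kappa>\<close> forces \<open>w\<close> to be constant there, so \<open>M = 0\<close> there, a contradiction; thus \<open>M\<close> is a
  constant \<open>m\<close>.  As \<open>w\<close> is not constant on the interval, \<open>m \<noteq> 0\<close>, and therefore \<open>w'\<close> never vanishes.
  With \<open>A\<^sub>2 = s / m\<^sup>2\<close> and \<open>B\<^sub>1 = - \<kappa> / m\<close> the equations become \<open>h' = (B\<^sub>1 / w)'\<close> and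
  \<open>(w p\<^sup>2)' = (A\<^sub>2 w - B\<^sub>1\<^sup>2 / w)'\<close>, so
  \<open>h = A\<^sub>1 + B\<^sub>1 / w\<close> and \<open>p\<^sup>2 = A\<^sub>2 + B\<^sub>2 / w - B\<^sub>1\<^sup>2 / w\<^sup>2\<close>, which is the asserted formula.  One sign of the square
  root serves the whole interval because \<open>p\<close> has no zero: with \<open>t = 1 / w\<close>, a zero would be a double zero of the
  polynomial \<open>A\<^sub>2 + B\<^sub>2 t - B\<^sub>1\<^sup>2 t\<^sup>2\<close>, which would then be nonpositive, forcing \<open>p = 0\<close> and \<open>w\<close> constant.
  Conversely, the formula gives \<open>S = A\<^sub>2 w'\<^sup>2\<close>, so \<open>M\<^sup>2\<close> and \<open>\<kappa> = - B\<^sub>1 M\<close> are constant.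
\<close>

section \<open>Continuously differentiable maps and the Wirtinger derivative\<close>

lemma integrable_on_compact:
  fixes f :: "'a::euclidean_space \<Rightarrow> 'b::euclidean_space"
  assumes "compact K" "continuous_on K f"
  shows "f integrable_on K"
  using set_borel_integral_eq_integral(1)[of K f] borel_integrable_compact[OF assms]
  unfolding set_integrable_def by blast

lemma integral_superset_support:
  fixes f :: "'a::euclidean_space \<Rightarrow> real"
  assumes "\<And>x. x \<notin> S \<Longrightarrow> f x = 0" "S \<subseteq> T"
  shows "integral T f = integral S f"
proof -
  have "(\<lambda>x. if x \<in> T then f x else 0) = (\<lambda>x. if x \<in> S then f x else 0)"
    using assms by fastforce
  then show ?thesis
    by (metis integral_restrict_UNIV)
qed

text \<open>
  The predicate \<open>Ck_on 1\<close> is used as the notion of a continuously differentiable map throughout; for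
  maps built from radial functions the derivative is known explicitly, which this rule exploits.
\<close>

lemma C1_onI:
  assumes "\<And>z. z \<in> S \<Longrightarrow> (f has_derivative D z) (at z)"
    and "\<And>v. continuous_on S (\<lambda>z. D z v)"
  shows "Ck_on 1 S f"
proof -
  have "frechet_derivative f (at z) = D z" if "z \<in> S" for z
    using frechet_derivative_at[OF assms(1)[OF that]] by simp
  then have "continuous_on S (\<lambda>z. frechet_derivative f (at z) v)" for v
    using assms(2)[of v] by (simp cong: continuous_on_cong)
  then show ?thesis
    using assms(1) by (auto simp: differentiable_def)
qed

lemma differentiable_of_C1_on: "Ck_on 1 S f \<Longrightarrow> z \<in> S \<Longrightarrow> f differentiable (at z)"
  by simp

lemma C1_on_has_derivative:
  "Ck_on 1 S f \<Longrightarrow> z \<in> S \<Longrightarrow> (f has_derivative frechet_derivative f (at z)) (at z)"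
  by (simp add: frechet_derivative_works)

lemma C1_on_continuous_derivative:
  "Ck_on 1 S f \<Longrightarrow> continuous_on S (\<lambda>z. frechet_derivative f (at z) v)"
  by simp

lemma C1_on_continuous: "Ck_on 1 S f \<Longrightarrow> continuous_on S f"
  by (auto intro!: continuous_at_imp_continuous_on differentiable_imp_continuous_within)

lemma C1_on_mult:
  fixes f g :: "complex \<Rightarrow> complex"
  assumes f: "Ck_on 1 S f" and g: "Ck_on 1 S g"
  shows "Ck_on 1 S (\<lambda>z. f z * g z)"
  by (rule C1_onI, rule has_derivative_mult[OF C1_on_has_derivative[OF f] C1_on_has_derivative[OF g]])
     (auto intro!: continuous_intros C1_on_continuous[OF f] C1_on_continuous[OF g]
        C1_on_continuous_derivative[OF f] C1_on_continuous_derivative[OF g])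

lemma C1_on_add:
  fixes f g :: "complex \<Rightarrow> complex"
  assumes f: "Ck_on 1 S f" and g: "Ck_on 1 S g"
  shows "Ck_on 1 S (\<lambda>z. f z + g z)"
  by (rule C1_onI, rule has_derivative_add[OF C1_on_has_derivative[OF f] C1_on_has_derivative[OF g]])
     (auto intro!: continuous_intros
        C1_on_continuous_derivative[OF f] C1_on_continuous_derivative[OF g])

lemma C1_on_bounded_linear:
  assumes f: "Ck_on 1 S f" and g: "bounded_linear g"
  shows "Ck_on 1 S (\<lambda>z. g (f z))"
  by (rule C1_onI, rule bounded_linear.has_derivative[OF g C1_on_has_derivative[OF f]])
     (auto intro!: bounded_linear.continuous_on[OF g] C1_on_continuous_derivative[OF f])

lemma C1_on_const: "Ck_on 1 S (\<lambda>z. c)"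
  by (rule C1_onI, rule has_derivative_const) simp

lemma C1_on_exp:
  fixes U :: "complex \<Rightarrow> real"
  assumes U: "Ck_on 1 S U"
  shows "Ck_on 1 S (\<lambda>z. complex_of_real (exp (2 * U z)))"
  by (rule C1_onI[where D="\<lambda>z v. of_real (exp (2 * U z) * (2 * frechet_derivative U (at z) v))"])
     (auto intro!: derivative_eq_intros C1_on_has_derivative[OF U] continuous_intros
         C1_on_continuous[OF U] C1_on_continuous_derivative[OF U] simp: algebra_simps)

lemma continuous_on_wirt:
  assumes "Ck_on 1 S f"
  shows "continuous_on S (wirt f)"
  unfolding wirt_def by (intro continuous_intros C1_on_continuous_derivative[OF assms]) simp

lemma wirt_eq:
  assumes "(f has_derivative D) (at z)"
  shows "wirt f z = (D 1 - \<i> * D \<i>) / 2"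
  using frechet_derivative_at[OF assms] by (simp add: wirt_def)

lemma wirt_mult:
  assumes "f differentiable at z" "g differentiable at z"
  shows "wirt (\<lambda>z. f z * g z) z = wirt f z * g z + f z * wirt g z"
  using assms unfolding frechet_derivative_works
  by (subst wirt_eq[OF has_derivative_mult]) (auto simp: wirt_def field_simps)

lemma wirt_add:
  assumes "f differentiable at z" "g differentiable at z"
  shows "wirt (\<lambda>z. f z + g z) z = wirt f z + wirt g z"
  using assms unfolding frechet_derivative_works
  by (subst wirt_eq[OF has_derivative_add]) (auto simp: wirt_def field_simps)

lemma wirt_cmult:
  assumes "f differentiable at z"
  shows "wirt (\<lambda>z. c * f z) z = c * wirt f z"
  using assms unfolding frechet_derivative_works
  by (subst wirt_eq[OF has_derivative_mult_right]) (auto simp: wirt_def field_simps)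

section \<open>Integration by parts for compactly supported maps\<close>

text \<open>
  The complement of the support is open, so the derivative vanishes there as well; this makes
  integrals over \<open>K\<close> and over any larger box agree.
\<close>

lemma frechet_derivative_eq_0_outside:
  assumes "closed K" "\<And>z. z \<notin> K \<Longrightarrow> f z = 0" "z \<notin> K"
  shows "frechet_derivative f (at z) = (\<lambda>v. 0)"
proof -
  have "(f has_derivative (\<lambda>v. 0)) (at z)"
    by (rule has_derivative_transform_within_open[where f="\<lambda>_. 0" and s="- K"])
       (use assms in auto)
  then show ?thesis
    using frechet_derivative_at by metis
qed

text \<open>
  Translation invariance replaces Fubini: \<open>\<integral> f (z + t v) dz\<close> is independent of \<open>t\<close>, and its
  derivative at \<open>t = 0\<close> is the integral of the directional derivative.
\<close>

lemma integral_directional_derivative_eq_0: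
  fixes f :: "'a::euclidean_space \<Rightarrow> real"
  assumes f: "Ck_on 1 UNIV f" and K: "compact K" and supp: "\<And>z. z \<notin> K \<Longrightarrow> f z = 0"
  shows "integral K (\<lambda>z. frechet_derivative f (at z) v) = 0"
proof -
  \<comment> \<open>one box must contain the supports of all translates with parameter at most 1 in absolute value\<close>
  define K' where "K' = (\<lambda>(z, t). z - t *\<^sub>R v) ` (K \<times> {-1..1::real})"
  have "compact K'"
    unfolding K'_def
    by (intro compact_continuous_image compact_Times K compact_Icc)
       (auto intro!: continuous_intros simp: case_prod_unfold)
  then obtain b where b: "K' \<subseteq> cbox (-b) b"
    using bounded_subset_cbox_symmetric[OF compact_imp_bounded] by blast
  have shift: "z - t *\<^sub>R v \<in> cbox (-b) b" if "z \<in> K" "t \<in> {-1..1}" for z t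
    using that b by (force simp: K'_def)
  have Kb: "K \<subseteq> cbox (-b) b"
    using shift[where t=0] by auto
  let ?g = "\<lambda>t. integral (cbox (-b) b) (\<lambda>z. f (z + t *\<^sub>R v))"
  have const: "?g t = integral (cbox (-b) b) f" if t: "t \<in> {-1..1}" for t
  proof -
    let ?K = "(\<lambda>z. z - t *\<^sub>R v) ` K"
    have supp': "f (z + t *\<^sub>R v) = 0" if "z \<notin> ?K" for z
    proof (rule supp)
      show "z + t *\<^sub>R v \<notin> K"
      proof
        assume "z + t *\<^sub>R v \<in> K"
        then have "z + t *\<^sub>R v - t *\<^sub>R v \<in> ?K" by blast
        then show False using that by simp
      qed
    qed
    have "?g t = integral ?K (\<lambda>z. f (z + t *\<^sub>R v))"
      by (rule integral_superset_support[OF supp']) (use shift t in auto)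
    also have "\<dots> = integral (cbox (-b - t *\<^sub>R v) (b - t *\<^sub>R v)) (\<lambda>z. f (z + t *\<^sub>R v))"
    proof (rule integral_superset_support[OF supp', symmetric])
      show "?K \<subseteq> cbox (-b - t *\<^sub>R v) (b - t *\<^sub>R v)"
        using Kb by (auto simp: mem_box inner_diff_left)
    qed
    also have "\<dots> = integral (cbox (-b) b) f"
      by (rule integral_shift_cbox)
    finally show ?thesis .
  qed
  have contf: "continuous_on UNIV f"
    by (rule C1_on_continuous[OF f])
  have contD: "continuous_on UNIV (\<lambda>z. frechet_derivative f (at z) v)"
    by (rule C1_on_continuous_derivative[OF f])
  have "(?g has_field_derivative
      integral (cbox (-b) b) (\<lambda>z. frechet_derivative f (at (z + 0 *\<^sub>R v)) v)) (at 0 within {-1..1})"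
  proof (rule leibniz_rule_field_derivative)
    fix t z
    let ?D = "frechet_derivative f (at (z + t *\<^sub>R v))"
    have D: "(f has_derivative ?D) (at (z + t *\<^sub>R v))"
      by (rule C1_on_has_derivative[OF f]) simp
    have "((\<lambda>t. f (z + t *\<^sub>R v)) has_derivative (\<lambda>h. ?D (h *\<^sub>R v))) (at t)"
      by (rule has_derivative_compose[where f="\<lambda>t. z + t *\<^sub>R v" and g=f, OF _ D])
         (auto intro!: derivative_eq_intros)
    moreover have "?D (h *\<^sub>R v) = ?D v * h" for h
      using linear_scale[OF has_derivative_linear[OF D], of h v] by simp
    ultimately show "((\<lambda>t. f (z + t *\<^sub>R v)) has_field_derivative ?D v) (at t within {-1..1})"
      by (simp add: has_field_derivative_def has_derivative_at_withinI)
  next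
    fix t
    show "(\<lambda>z. f (z + t *\<^sub>R v)) integrable_on cbox (-b) b"
      by (intro integrable_continuous continuous_on_compose2[OF contf] continuous_intros) auto
  next
    show "continuous_on ({-1..1} \<times> cbox (-b) b)
        (\<lambda>(t, z). frechet_derivative f (at (z + t *\<^sub>R v)) v)"
      unfolding case_prod_unfold
      by (rule continuous_on_compose2[OF contD]) (auto intro!: continuous_intros)
  qed auto
  moreover have "(?g has_field_derivative 0) (at 0 within {-1..1})"
    by (rule has_field_derivative_transform_within[where f="\<lambda>_. integral (cbox (-b) b) f" and d=1])
       (use const in auto)
  moreover have "at (0::real) within {-1..1} = at 0"
    by (rule at_within_interior) simp
  ultimately have "integral (cbox (-b) b) (\<lambda>z. frechet_derivative f (at z) v) = 0"
    using DERIV_unique by auto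
  moreover have "frechet_derivative f (at z) v = 0" if "z \<notin> K" for z
    using frechet_derivative_eq_0_outside[OF compact_imp_closed[OF K] supp that] by simp
  ultimately show ?thesis
    using integral_superset_support[of K "\<lambda>z. frechet_derivative f (at z) v", OF _ Kb] by simp
qed

text \<open>
  The divergence theorem in complex notation: regarding \<open>X\<close> as a planar vector field, its divergence
  is \<open>2 Re (\<partial>X)\<close>.
\<close>

lemma integral_Re_wirt_eq_0:
  fixes X :: "complex \<Rightarrow> complex"
  assumes X: "Ck_on 1 UNIV X" and K: "compact K" and supp: "\<And>z. z \<notin> K \<Longrightarrow> X z = 0"
  shows "integral K (\<lambda>z. Re (wirt X z)) = 0"
proof -
  let ?D = "\<lambda>v z. frechet_derivative X (at z) v"
  have D: "(X has_derivative (\<lambda>v. ?D v z)) (at z)" for z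
    using C1_on_has_derivative[OF X] by simp
  have re: "integral K (\<lambda>z. Re (?D 1 z)) = 0"
  proof -
    have "Re (?D v z) = frechet_derivative (\<lambda>z. Re (X z)) (at z) v" for v z
      by (rule fun_cong[OF frechet_derivative_at], rule bounded_linear.has_derivative[OF bounded_linear_Re D])
    moreover have "integral K (\<lambda>z. frechet_derivative (\<lambda>z. Re (X z)) (at z) 1) = 0"
      by (rule integral_directional_derivative_eq_0[OF C1_on_bounded_linear[OF X bounded_linear_Re] K])
         (use supp in auto)
    ultimately show ?thesis by simp
  qed
  have im: "integral K (\<lambda>z. Im (?D \<i> z)) = 0"
  proof -
    have "Im (?D v z) = frechet_derivative (\<lambda>z. Im (X z)) (at z) v" for v z
      by (rule fun_cong[OF frechet_derivative_at], rule bounded_linear.has_derivative[OF bounded_linear_Im D])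
    moreover have "integral K (\<lambda>z. frechet_derivative (\<lambda>z. Im (X z)) (at z) \<i>) = 0"
      by (rule integral_directional_derivative_eq_0[OF C1_on_bounded_linear[OF X bounded_linear_Im] K])
         (use supp in auto)
    ultimately show ?thesis by simp
  qed
  have c: "continuous_on K (?D v)" for v
    using C1_on_continuous_derivative[OF X] continuous_on_subset by blast
  have "integral K (\<lambda>z. Re (wirt X z)) = integral K (\<lambda>z. (Re (?D 1 z) + Im (?D \<i> z)) / 2)"
    by (simp add: wirt_def)
  also have "\<dots> = 0"
    by (simp add: integral_divide integral_add integrable_on_compact[OF K] continuous_on_Re continuous_on_Im c re im)
  finally show ?thesis .
qed

section \<open>Differentiation of the area under the integral sign\<close>

text \<open>
  With \<open>x = \<surd>\<bar>D\<bar>\<close> and \<open>y\<close> the perturbed root, the remainder is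
  \<open>(t\<^sup>2 sgn D G - (y - x)\<^sup>2) / (2 x)\<close>, because \<open>2 x (y - x) = (y\<^sup>2 - x\<^sup>2) - (y - x)\<^sup>2\<close>.  The bound depends
  on the coefficients only through \<open>d\<close> and \<open>B\<close>, so it is uniform over a compact set.
\<close>

lemma sqrt_abs_first_order_bound:
  fixes D E G t d B :: real
  assumes "0 < d" "d \<le> \<bar>D\<bar>" "\<bar>E\<bar> \<le> B" "\<bar>G\<bar> \<le> B" "\<bar>t\<bar> \<le> 1" "3 * B * \<bar>t\<bar> < d"
  shows "\<bar>sqrt \<bar>D + 2 * t * E + t\<^sup>2 * G\<bar> - sqrt \<bar>D\<bar> - t * (sgn D * E / sqrt \<bar>D\<bar>)\<bar>
    \<le> (9 * B\<^sup>2 / d + B) / (2 * sqrt d) * t\<^sup>2"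
proof -
  define q where "q = 2 * t * E + t\<^sup>2 * G"
  define x where "x = sqrt \<bar>D\<bar>"
  define y where "y = sqrt \<bar>D + q\<bar>"
  have x: "sqrt d \<le> x" "0 < x" "0 < sqrt d" and D: "D \<noteq> 0"
    using assms(1,2) by (auto simp: x_def)
  have tt: "t\<^sup>2 \<le> \<bar>t\<bar>"
  proof -
    have "t\<^sup>2 = \<bar>t\<bar> * \<bar>t\<bar>"
      by (simp add: power2_eq_square)
    also have "\<dots> \<le> \<bar>t\<bar> * 1"
      using assms(5) by (intro mult_left_mono) auto
    finally show ?thesis by simp
  qed
  have "\<bar>q\<bar> \<le> 2 * \<bar>t\<bar> * \<bar>E\<bar> + t\<^sup>2 * \<bar>G\<bar>"
    unfolding q_def by (rule order_trans[OF abs_triangle_ineq]) (simp add: abs_mult)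
  also have "\<dots> \<le> 2 * \<bar>t\<bar> * B + \<bar>t\<bar> * B"
    by (intro add_mono mult_mono assms tt) auto
  finally have q: "\<bar>q\<bar> \<le> 3 * B * \<bar>t\<bar>" by (simp add: algebra_simps)
  \<comment> \<open>the perturbation is too small to change the sign of D\<close>
  have "\<bar>D + q\<bar> = \<bar>D\<bar> + sgn D * q"
    using q assms(2,6) D by (auto simp: sgn_if abs_if split: if_splits)
  then have yx: "y\<^sup>2 - x\<^sup>2 = sgn D * q"
    by (simp add: x_def y_def)
  have y0: "0 \<le> y" by (simp add: y_def)
  have "(y - x) * (y + x) = sgn D * q"
    using yx by (simp add: power2_eq_square algebra_simps)
  then have "\<bar>y - x\<bar> * (y + x) = \<bar>q\<bar>"
    using y0 x D by (metis abs_mult abs_of_nonneg abs_sgn_eq_1 add_nonneg_nonneg less_imp_le mult_1)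
  moreover have "\<bar>y - x\<bar> * sqrt d \<le> \<bar>y - x\<bar> * (y + x)"
    using y0 x by (intro mult_left_mono) auto
  ultimately have "\<bar>y - x\<bar> * sqrt d \<le> 3 * B * \<bar>t\<bar>"
    using q by simp
  then have "(\<bar>y - x\<bar> * sqrt d)\<^sup>2 \<le> (3 * B * \<bar>t\<bar>)\<^sup>2"
    using x by (intro power_mono) auto
  then have yx2: "(y - x)\<^sup>2 \<le> 9 * B\<^sup>2 / d * t\<^sup>2"
    using assms(1) by (simp add: power_mult_distrib field_simps)
  have "y - x - t * (sgn D * E / x) = (2 * x * (y - x) - 2 * t * (sgn D * E)) / (2 * x)"
    using less_imp_neq[OF x(2)] by (simp add: diff_divide_distrib add_divide_distrib)
  also have "2 * x * (y - x) - 2 * t * (sgn D * E) = (y\<^sup>2 - x\<^sup>2) - (y - x)\<^sup>2 - 2 * t * (sgn D * E)"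
    by (simp add: power2_eq_square algebra_simps)
  also have "\<dots> = t\<^sup>2 * (sgn D * G) - (y - x)\<^sup>2"
    by (simp add: yx q_def algebra_simps)
  finally have "\<bar>y - x - t * (sgn D * E / x)\<bar> = \<bar>t\<^sup>2 * (sgn D * G) - (y - x)\<^sup>2\<bar> / (2 * x)"
    using abs_of_pos[of "2 * x"] x(2) by (simp only: abs_divide)
  also have "\<dots> \<le> (t\<^sup>2 * B + 9 * B\<^sup>2 / d * t\<^sup>2) / (2 * x)"
  proof (intro divide_right_mono)
    have "\<bar>t\<^sup>2 * (sgn D * G)\<bar> \<le> t\<^sup>2 * B"
      using assms(4) D by (simp add: abs_mult abs_sgn_eq mult_left_mono)
    then show "\<bar>t\<^sup>2 * (sgn D * G) - (y - x)\<^sup>2\<bar> \<le> t\<^sup>2 * B + 9 * B\<^sup>2 / d * t\<^sup>2"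
      using yx2 zero_le_power2[of "y - x"] by linarith
  qed (use x(2) in simp)
  also have "\<dots> \<le> (t\<^sup>2 * B + 9 * B\<^sup>2 / d * t\<^sup>2) / (2 * sqrt d)"
    using x assms(1,3) mult_pos_pos[OF x(2,3)]
    by (intro divide_left_mono add_nonneg_nonneg mult_nonneg_nonneg) auto
  also have "\<dots> = (9 * B\<^sup>2 / d + B) / (2 * sqrt d) * t\<^sup>2"
    by (simp add: add_divide_distrib algebra_simps)
  finally show ?thesis
    by (simp add: x_def y_def q_def algebra_simps)
qed

lemma has_real_derivative_quadratic_remainder:
  fixes f :: "real \<Rightarrow> real"
  assumes "0 < \<delta>" and bound: "\<And>t. \<bar>t\<bar> < \<delta> \<Longrightarrow> \<bar>f t - f 0 - t * f'\<bar> \<le> C * t\<^sup>2"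
  shows "(f has_real_derivative f') (at 0)"
proof -
  have "((\<lambda>t. (f t - f 0) / t - f') \<longlongrightarrow> 0) (at 0)"
  proof (rule Lim_null_comparison)
    show "((\<lambda>t. C * \<bar>t\<bar>) \<longlongrightarrow> 0) (at 0)"
      by (auto intro!: tendsto_eq_intros)
    show "\<forall>\<^sub>F t in at 0. norm ((f t - f 0) / t - f') \<le> C * \<bar>t\<bar>"
      unfolding eventually_at
    proof (intro exI[of _ \<delta>] conjI ballI impI)
      fix t :: real assume t: "t \<noteq> 0 \<and> dist t 0 < \<delta>"
      then have "\<bar>f t - f 0 - t * f'\<bar> / \<bar>t\<bar> \<le> C * t\<^sup>2 / \<bar>t\<bar>"
        by (intro divide_right_mono bound) auto
      also have "C * t\<^sup>2 / \<bar>t\<bar> = C * \<bar>t\<bar>"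
        using t by (cases "0 \<le> t") (auto simp: power2_eq_square)
      also have "\<bar>f t - f 0 - t * f'\<bar> / \<bar>t\<bar> = \<bar>(f t - f 0) / t - f'\<bar>"
        using t by (simp add: diff_divide_distrib abs_divide[symmetric] del: abs_divide)
      finally show "norm ((f t - f 0) / t - f') \<le> C * \<bar>t\<bar>" by simp
    qed (use assms(1) in auto)
  qed
  then show ?thesis
    unfolding DERIV_def by (simp add: LIM_zero_iff)
qed

lemma compact_continuous_abs_bound:
  fixes f :: "'a::topological_space \<Rightarrow> real"
  assumes "compact K" "continuous_on K f"
  obtains B where "0 \<le> B" "\<And>z. z \<in> K \<Longrightarrow> \<bar>f z\<bar> \<le> B"
proof -
  have "bounded (f ` K)"
    by (intro compact_imp_bounded compact_continuous_image assms)
  then obtain B where "\<forall>x\<in>f ` K. norm x \<le> B" by (auto simp: bounded_iff)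
  then show ?thesis by (intro that[of "max B 0"]) (auto simp: le_max_iff_disj)
qed

lemma compact_continuous_abs_lower_bound:
  fixes f :: "'a::topological_space \<Rightarrow> real"
  assumes "compact K" "continuous_on K f" "\<And>z. z \<in> K \<Longrightarrow> f z \<noteq> 0"
  obtains d where "0 < d" "\<And>z. z \<in> K \<Longrightarrow> d \<le> \<bar>f z\<bar>"
proof -
  have "continuous_on K (\<lambda>z. inverse (f z))"
    using assms by (intro continuous_intros) auto
  then obtain B where B: "0 \<le> B" "\<And>z. z \<in> K \<Longrightarrow> \<bar>inverse (f z)\<bar> \<le> B"
    using compact_continuous_abs_bound[OF assms(1)] by metis
  show ?thesis
  proof (rule that[of "1 / (B + 1)"])
    fix z assume z: "z \<in> K"
    have "1 = \<bar>inverse (f z)\<bar> * \<bar>f z\<bar>"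
      using assms(3)[OF z] by (simp flip: abs_mult)
    also have "\<dots> \<le> (B + 1) * \<bar>f z\<bar>"
      using B(2)[OF z] by (intro mult_right_mono) auto
    finally show "1 / (B + 1) \<le> \<bar>f z\<bar>"
      using B(1) by (simp add: field_simps)
  qed (use B in auto)
qed

text \<open>
  Since \<open>D\<close> is bounded away from zero on the compact set, the pointwise second-order remainder
  is bounded by a fixed multiple of \<open>t\<^sup>2\<close>, which survives integration.
\<close>

lemma has_real_derivative_integral_sqrt_quadratic:
  fixes c D E G :: "'a::euclidean_space \<Rightarrow> real"
  assumes K: "compact K"
    and cont: "continuous_on K c" "continuous_on K D" "continuous_on K E" "continuous_on K G"
    and D0: "\<And>z. z \<in> K \<Longrightarrow> D z \<noteq> 0"
  shows "((\<lambda>t. integral K (\<lambda>z. c z * sqrt \<bar>D z + 2 * t * E z + t\<^sup>2 * G z\<bar>)) has_real_derivative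
    integral K (\<lambda>z. c z * (sgn (D z) * E z / sqrt \<bar>D z\<bar>))) (at 0)"
proof -
  obtain d where d: "0 < d" "\<And>z. z \<in> K \<Longrightarrow> d \<le> \<bar>D z\<bar>"
    using compact_continuous_abs_lower_bound[OF K cont(2) D0] by metis
  obtain BE where BE: "0 \<le> BE" "\<And>z. z \<in> K \<Longrightarrow> \<bar>E z\<bar> \<le> BE"
    using compact_continuous_abs_bound[OF K cont(3)] by metis
  obtain BG where BG: "0 \<le> BG" "\<And>z. z \<in> K \<Longrightarrow> \<bar>G z\<bar> \<le> BG"
    using compact_continuous_abs_bound[OF K cont(4)] by metis
  define B where "B = max BE BG"
  have B: "0 \<le> B" "\<And>z. z \<in> K \<Longrightarrow> \<bar>E z\<bar> \<le> B" "\<And>z. z \<in> K \<Longrightarrow> \<bar>G z\<bar> \<le> B"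
    using BE BG by (auto simp: B_def le_max_iff_disj)
  define C where "C = (9 * B\<^sup>2 / d + B) / (2 * sqrt d)"
  define \<delta> where "\<delta> = min 1 (d / (3 * B + 1))"
  have sgnD: "sgn (D z) * E z / sqrt \<bar>D z\<bar> = D z * E z / (\<bar>D z\<bar> * sqrt \<bar>D z\<bar>)" for z
    by (simp add: sgn_div_norm divide_inverse)
  have contV: "continuous_on K (\<lambda>z. sgn (D z) * E z / sqrt \<bar>D z\<bar>)"
    unfolding sgnD using D0 by (intro continuous_intros cont) auto
  have contW: "continuous_on K (\<lambda>z. sqrt \<bar>D z + 2 * t * E z + t\<^sup>2 * G z\<bar>)" for t
    by (intro continuous_intros cont)
  show ?thesis
  proof (rule has_real_derivative_quadratic_remainder[where C="integral K (\<lambda>z. \<bar>c z\<bar> * C)"])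
    show "0 < \<delta>" using d B by (simp add: \<delta>_def)
    fix t :: real assume t: "\<bar>t\<bar> < \<delta>"
    have t1: "\<bar>t\<bar> \<le> 1" using t by (simp add: \<delta>_def)
    have "\<bar>t\<bar> * (3 * B + 1) < d"
      using t B(1) by (simp add: \<delta>_def pos_less_divide_eq)
    then have t2: "3 * B * \<bar>t\<bar> < d" by (simp add: algebra_simps)
    let ?W = "\<lambda>t z. sqrt \<bar>D z + 2 * t * E z + t\<^sup>2 * G z\<bar>"
    let ?V = "\<lambda>z. sgn (D z) * E z / sqrt \<bar>D z\<bar>"
    have iW: "(\<lambda>z. c z * ?W t z) integrable_on K" for t
      by (intro integrable_on_compact[OF K] continuous_on_mult cont(1) contW)
    have itV: "(\<lambda>z. t * (c z * ?V z)) integrable_on K" for t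
      by (intro integrable_on_compact[OF K] continuous_on_mult continuous_on_const cont(1) contV)
    have diff: "integral K (\<lambda>z. c z * ?W t z) - integral K (\<lambda>z. c z * ?W 0 z) - t * integral K (\<lambda>z. c z * ?V z)
       = integral K (\<lambda>z. c z * ?W t z - c z * ?W 0 z - t * (c z * ?V z))"
      unfolding integral_diff[OF integrable_diff[OF iW[of t] iW[of 0]] itV[of t]] integral_diff[OF iW[of t] iW[of 0]]
        integral_mult_right[of K t "\<lambda>z. c z * ?V z"] ..
    have bound: "\<bar>integral K (\<lambda>z. c z * ?W t z - c z * ?W 0 z - t * (c z * ?V z))\<bar> \<le> integral K (\<lambda>z. \<bar>c z\<bar> * C * t\<^sup>2)"
    proof (rule integral_norm_bound_integral[where f="\<lambda>z. c z * ?W t z - c z * ?W 0 z - t * (c z * ?V z)", unfolded real_norm_def])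
      show "(\<lambda>z. c z * ?W t z - c z * ?W 0 z - t * (c z * ?V z)) integrable_on K"
        by (intro integrable_diff iW itV)
      show "(\<lambda>z. \<bar>c z\<bar> * C * t\<^sup>2) integrable_on K"
        by (intro integrable_on_compact[OF K] continuous_on_mult continuous_on_rabs continuous_on_const cont(1))
      fix z assume z: "z \<in> K"
      have "\<bar>?W t z - ?W 0 z - t * ?V z\<bar> \<le> C * t\<^sup>2"
        unfolding C_def using sqrt_abs_first_order_bound[OF d(1) d(2)[OF z] B(2,3)[OF z] t1 t2] by simp
      then have "\<bar>c z\<bar> * \<bar>?W t z - ?W 0 z - t * ?V z\<bar> \<le> \<bar>c z\<bar> * (C * t\<^sup>2)"
        by (intro mult_left_mono) auto
      moreover have "c z * ?W t z - c z * ?W 0 z - t * (c z * ?V z) = c z * (?W t z - ?W 0 z - t * ?V z)"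
        by (simp add: algebra_simps)
      ultimately show "\<bar>c z * ?W t z - c z * ?W 0 z - t * (c z * ?V z)\<bar> \<le> \<bar>c z\<bar> * C * t\<^sup>2"
        by (simp only: abs_mult mult.assoc)
    qed
    have const: "integral K (\<lambda>z. \<bar>c z\<bar> * C * t\<^sup>2) = integral K (\<lambda>z. \<bar>c z\<bar> * C) * t\<^sup>2"
      by simp
    show "\<bar>integral K (\<lambda>z. c z * ?W t z) - integral K (\<lambda>z. c z * ?W 0 z) - t * integral K (\<lambda>z. c z * ?V z)\<bar>
       \<le> integral K (\<lambda>z. \<bar>c z\<bar> * C) * t\<^sup>2"
      unfolding diff const[symmetric] by (rule bound)
  qed
qed

section \<open>The first variation of the area of a graph\<close>

text \<open>
  The metric coefficients are real-linear in the section, so \<open>\<lambda>\<^sup>2 - \<bar>\<sigma>\<bar>\<^sup>2\<close> is a quadratic polynomial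
  in the variation parameter.
\<close>

lemma sigma_add_scaled:
  assumes "F differentiable (at z)" "\<phi> differentiable (at z)"
  shows "sigma (\<lambda>z. F z + of_real t * \<phi> z) z = sigma F z + of_real t * sigma \<phi> z"
proof -
  have d: "(\<lambda>z. cnj (F z)) differentiable (at z)" "(\<lambda>z. cnj (\<phi> z)) differentiable (at z)"
    using assms bounded_linear.has_derivative[OF bounded_linear_cnj] unfolding differentiable_def by blast+
  have d': "(\<lambda>z. of_real t * cnj (\<phi> z)) differentiable (at z)"
    by (rule differentiable_mult[OF differentiable_const d(2)])
  show ?thesis
    by (simp add: sigma_def wirt_add[OF d(1) d'] wirt_cmult[OF d(2)])
qed

lemma lambda_add_scaled:
  assumes "F differentiable (at z)" "\<phi> differentiable (at z)" "U differentiable (at z)"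
  shows "lambda U (\<lambda>z. F z + of_real t * \<phi> z) z = lambda U F z + t * lambda U \<phi> z"
proof -
  have "((\<lambda>z. complex_of_real (exp (2 * U z))) has_derivative
      (\<lambda>v. of_real (exp (2 * U z) * (2 * frechet_derivative U (at z) v)))) (at z)"
    using assms(3) unfolding frechet_derivative_works
    by (auto intro!: derivative_eq_intros simp: algebra_simps)
  then have e: "(\<lambda>z. complex_of_real (exp (2 * U z))) differentiable (at z)"
    unfolding differentiable_def by blast
  note d = differentiable_mult[OF assms(1) e] differentiable_mult[OF assms(2) e]
  have d': "(\<lambda>z. of_real t * (\<phi> z * complex_of_real (exp (2 * U z)))) differentiable (at z)"
    by (rule differentiable_mult[OF differentiable_const d(2)])
  have "wirt (\<lambda>z. (F z + of_real t * \<phi> z) * complex_of_real (exp (2 * U z))) z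
     = wirt (\<lambda>z. F z * complex_of_real (exp (2 * U z)) + of_real t * (\<phi> z * complex_of_real (exp (2 * U z)))) z"
    by (simp only: distrib_right mult.assoc)
  also have "\<dots> = wirt (\<lambda>z. F z * complex_of_real (exp (2 * U z))) z
      + of_real t * wirt (\<lambda>z. \<phi> z * complex_of_real (exp (2 * U z))) z"
    by (simp only: wirt_add[OF d(1) d'] wirt_cmult[OF d(2)])
  finally show ?thesis
    by (simp add: lambda_def algebra_simps)
qed

lemma continuous_on_sigma:
  assumes "Ck_on 1 S F"
  shows "continuous_on S (sigma F)"
  unfolding sigma_def
  by (intro continuous_intros continuous_on_wirt C1_on_bounded_linear[OF assms bounded_linear_cnj])

lemma continuous_on_lambda:
  assumes "Ck_on 1 S F" "Ck_on 1 S U"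
  shows "continuous_on S (lambda U F)"
  unfolding lambda_def
  by (intro continuous_intros continuous_on_wirt C1_on_mult C1_on_exp C1_on_continuous assms)

text \<open>
  Products of the coefficients, which are controlled only on \<open>\<Omega>\<close>, with a variation supported in
  \<open>K\<close> are continuously differentiable on the whole plane, as required for integration by parts.
\<close>

lemma C1_on_UNIV_of_support:
  assumes "open \<Omega>" "closed K" "K \<subseteq> \<Omega>" and X: "Ck_on 1 \<Omega> X" and supp: "\<And>z. z \<notin> K \<Longrightarrow> X z = 0"
  shows "Ck_on 1 UNIV X"
proof -
  have U: "(UNIV :: 'a set) = \<Omega> \<union> - K" using assms(3) by auto
  have out: "(X has_derivative (\<lambda>v. 0)) (at z)" if "z \<notin> K" for z
    by (rule has_derivative_transform_within_open[where f="\<lambda>_. 0" and s="- K"])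
       (use assms that in auto)
  have D: "(X has_derivative frechet_derivative X (at z)) (at z)" for z
  proof (cases "z \<in> \<Omega>")
    case False
    then have "X differentiable (at z)"
      using out[of z] assms(3) unfolding differentiable_def by blast
    then show ?thesis
      by (simp add: frechet_derivative_works)
  qed (rule C1_on_has_derivative[OF X])
  have "continuous_on (- K) (\<lambda>z. frechet_derivative X (at z) v)" for v
    using frechet_derivative_at[OF out] by (intro continuous_on_eq[OF continuous_on_const[where c=0]]) (metis ComplD)
  then have "continuous_on UNIV (\<lambda>z. frechet_derivative X (at z) v)" for v
    using continuous_on_open_Un[OF assms(1) _ C1_on_continuous_derivative[OF X], of "- K" v] assms(2) U
    by (simp add: open_Compl)
  then show ?thesis
    using D by (intro C1_onI)
qed

text \<open>
  Here \<open>l\<close> and \<open>\<tau>\<close> are \<open>\<lambda> / \<surd>\<bar>D\<bar>\<close> and the conjugate of \<open>e\<^sup>2\<^sup>U \<sigma> / \<surd>\<bar>D\<bar>\<close>, both with the sign of \<open>D\<close>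
  included; the multiplier \<open>\<Gamma>\<close> of \<open>\<phi>\<close> is then \<open>e\<^sup>2\<^sup>U\<close> times the Euler-Lagrange expression.  The derivative of the
  integrand is \<open>2 Re (- i l \<partial>(e\<^sup>2\<^sup>U \<phi>) + \<tau> \<partial>(\<phi>\<^sup>*))\<close>, so it differs from \<open>2 Re (\<Gamma> \<phi>)\<close> by the divergence of
  \<open>X = - i l e\<^sup>2\<^sup>U \<phi> + \<tau> \<phi>\<^sup>*\<close>.
\<close>

lemma first_variation_of_area:
  fixes U :: "complex \<Rightarrow> real" and F \<phi> l \<tau> :: "complex \<Rightarrow> complex"
  defines "D \<equiv> \<lambda>z. (lambda U F z)\<^sup>2 - (cmod (sigma F z))\<^sup>2"
  assumes \<Omega>: "open \<Omega>" and K: "compact K" "K \<subseteq> \<Omega>"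
    and U: "Ck_on 1 \<Omega> U" and F: "Ck_on 1 \<Omega> F"
    and \<phi>: "Ck_on 1 UNIV \<phi>" and supp: "\<And>z. z \<notin> K \<Longrightarrow> \<phi> z = 0"
    and D0: "\<And>z. z \<in> \<Omega> \<Longrightarrow> D z \<noteq> 0"
    and l: "Ck_on 1 \<Omega> l" and l_eq: "\<And>z. z \<in> \<Omega> \<Longrightarrow> l z = of_real (sgn (D z) * lambda U F z / sqrt \<bar>D z\<bar>)"
    and \<tau>: "Ck_on 1 \<Omega> \<tau>"
    and \<tau>_eq: "\<And>z. z \<in> \<Omega> \<Longrightarrow> \<tau> z = of_real (exp (2 * U z) * sgn (D z) / sqrt \<bar>D z\<bar>) * cnj (sigma F z)"
  shows "((\<lambda>t. graph_area U K (\<lambda>z. F z + of_real t * \<phi> z)) has_real_derivative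
    integral K (\<lambda>z. 2 * Re ((\<i> * of_real (exp (2 * U z)) * wirt l z - cnj (wirt \<tau> z)) * \<phi> z))) (at 0)"
    (is "(_ has_real_derivative integral K ?R) _")
proof -
  \<comment> \<open>the discriminant of F + t phi is D + 2 t E + t^2 G\<close>
  define E where "E = (\<lambda>z. lambda U F z * lambda U \<phi> z - Re (cnj (sigma F z) * sigma \<phi> z))"
  define G where "G = (\<lambda>z. (lambda U \<phi> z)\<^sup>2 - (cmod (sigma \<phi> z))\<^sup>2)"
  define e where "e = (\<lambda>z. complex_of_real (exp (2 * U z)))"
  have \<phi>\<Omega>: "Ck_on 1 \<Omega> \<phi>"
    using \<phi> by (auto intro: continuous_on_subset)
  have e: "Ck_on 1 \<Omega> e"
    unfolding e_def by (rule C1_on_exp[OF U])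
  note dU = differentiable_of_C1_on[OF U] and dF = differentiable_of_C1_on[OF F]
    and d\<phi> = differentiable_of_C1_on[OF \<phi>\<Omega>]
  have area: "sqrt \<bar>gram_det (induced_metric U (\<lambda>z. F z + of_real t * \<phi> z) z)\<bar>
      = 2 * exp (2 * U z) * sqrt \<bar>D z + 2 * t * E z + t\<^sup>2 * G z\<bar>" if z: "z \<in> K" for t z
  proof -
    have z\<Omega>: "z \<in> \<Omega>" using z K by auto
    have d: "(\<lambda>z. F z + of_real t * \<phi> z) differentiable (at z)"
      by (intro differentiable_add differentiable_mult differentiable_const dF d\<phi> z\<Omega>)
    have "gram_det (induced_metric U (\<lambda>z. F z + of_real t * \<phi> z) z)
        = (2 * exp (2 * U z))\<^sup>2 * (D z + 2 * t * E z + t\<^sup>2 * G z)"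
      unfolding gram_det_induced_metric[OF d dU[OF z\<Omega>]] sigma_add_scaled[OF dF[OF z\<Omega>] d\<phi>[OF z\<Omega>]]
        lambda_add_scaled[OF dF[OF z\<Omega>] d\<phi>[OF z\<Omega>] dU[OF z\<Omega>]]
      unfolding D_def E_def G_def cmod_power2
      by simp (simp add: power2_eq_square algebra_simps)
    then show ?thesis
      by (simp add: abs_mult real_sqrt_mult)
  qed
  have cont: "continuous_on K D" "continuous_on K E" "continuous_on K G"
    "continuous_on K (\<lambda>z. 2 * exp (2 * U z))"
    unfolding D_def E_def G_def
    by (intro continuous_intros continuous_on_subset[OF continuous_on_sigma K(2)]
         continuous_on_subset[OF continuous_on_lambda K(2)] continuous_on_subset[OF C1_on_continuous K(2)]
         U F \<phi>\<Omega>)+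
  have deriv: "((\<lambda>t. graph_area U K (\<lambda>z. F z + of_real t * \<phi> z)) has_real_derivative
      integral K (\<lambda>z. 2 * exp (2 * U z) * (sgn (D z) * E z / sqrt \<bar>D z\<bar>))) (at 0)"
  proof -
    have "(\<lambda>t. graph_area U K (\<lambda>z. F z + of_real t * \<phi> z))
       = (\<lambda>t. integral K (\<lambda>z. 2 * exp (2 * U z) * sqrt \<bar>D z + 2 * t * E z + t\<^sup>2 * G z\<bar>))"
      unfolding graph_area_def by (intro ext integral_cong area)
    then show ?thesis
      using has_real_derivative_integral_sqrt_quadratic[OF K(1) cont(4,1,2,3)] D0 K(2) by auto
  qed
  define X where "X = (\<lambda>z. - \<i> * l z * (\<phi> z * e z) + \<tau> z * cnj (\<phi> z))"
  have cn\<phi>: "Ck_on 1 \<Omega> (\<lambda>z. cnj (\<phi> z))"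
    by (rule C1_on_bounded_linear[OF \<phi>\<Omega> bounded_linear_cnj])
  note C1 = C1_on_mult[OF C1_on_mult[OF C1_on_const[of \<Omega> "-\<i>"] l] C1_on_mult[OF \<phi>\<Omega> e]] C1_on_mult[OF \<tau> cn\<phi>]
  have X1: "Ck_on 1 \<Omega> X"
    unfolding X_def by (rule C1_on_add[OF C1])
  have X0: "X z = 0" if "z \<notin> K" for z
    using supp[OF that] by (simp add: X_def)
  have XU: "Ck_on 1 UNIV X"
    by (rule C1_on_UNIV_of_support[OF \<Omega> compact_imp_closed[OF K(1)] K(2) X1 X0])
  have pointwise: "2 * exp (2 * U z) * (sgn (D z) * E z / sqrt \<bar>D z\<bar>) = 2 * Re (wirt X z) + ?R z"
    if z: "z \<in> K" for z
  proof -
    have z\<Omega>: "z \<in> \<Omega>" using z K by auto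
    note dd = C1[THEN differentiable_of_C1_on, OF z\<Omega>]
    define q where "q = sgn (D z) * lambda U F z / sqrt \<bar>D z\<bar>"
    have lq: "l z = of_real q"
      using l_eq[OF z\<Omega>] by (simp only: q_def)
    have wX: "wirt X z = - \<i> * wirt l z * (\<phi> z * e z) - \<i> * l z * wirt (\<lambda>z. \<phi> z * e z) z
        + wirt \<tau> z * cnj (\<phi> z) + \<tau> z * wirt (\<lambda>z. cnj (\<phi> z)) z"
      unfolding X_def
      using wirt_add[OF dd]
        wirt_mult[OF differentiable_of_C1_on[OF C1_on_mult[OF C1_on_const[of \<Omega> "-\<i>"] l] z\<Omega>]
          differentiable_of_C1_on[OF C1_on_mult[OF \<phi>\<Omega> e] z\<Omega>]]
        wirt_cmult[OF differentiable_of_C1_on[OF l z\<Omega>], of "-\<i>"]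
        wirt_mult[OF differentiable_of_C1_on[OF \<tau> z\<Omega>] differentiable_of_C1_on[OF cn\<phi> z\<Omega>]]
      by simp
    have wl: "exp (2 * U z) * lambda U \<phi> z = Im (wirt (\<lambda>z. \<phi> z * e z) z)"
      by (simp add: lambda_def e_def mult.assoc[symmetric] exp_add[symmetric])
    have ws: "wirt (\<lambda>z. cnj (\<phi> z)) z = - sigma \<phi> z"
      by (simp add: sigma_def)
    have V: "2 * exp (2 * U z) * (sgn (D z) * E z / sqrt \<bar>D z\<bar>)
       = 2 * (q * (exp (2 * U z) * lambda U \<phi> z)
          - Re (of_real (exp (2 * U z) * sgn (D z) / sqrt \<bar>D z\<bar>) * cnj (sigma F z) * sigma \<phi> z))"
      unfolding E_def q_def by (simp add: add_divide_distrib diff_divide_distrib algebra_simps)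
    show ?thesis
      unfolding V wX \<tau>_eq[OF z\<Omega>, symmetric] wl ws lq
      by (simp add: e_def algebra_simps)
  qed
  have contR: "continuous_on K ?R"
    by (intro continuous_intros continuous_on_subset[OF continuous_on_wirt K(2)]
         continuous_on_subset[OF C1_on_continuous K(2)] U l \<tau> \<phi>\<Omega>)
  have contX: "continuous_on K (\<lambda>z. Re (wirt X z))"
    by (intro continuous_intros continuous_on_subset[OF continuous_on_wirt K(2)] X1)
  have iX: "(\<lambda>z. 2 * Re (wirt X z)) integrable_on K"
    by (intro integrable_on_compact[OF K(1)] continuous_on_mult continuous_on_const contX)
  have iR: "?R integrable_on K"
    by (rule integrable_on_compact[OF K(1) contR])
  have "integral K (\<lambda>z. 2 * exp (2 * U z) * (sgn (D z) * E z / sqrt \<bar>D z\<bar>))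
      = integral K (\<lambda>z. 2 * Re (wirt X z) + ?R z)"
    by (intro integral_cong pointwise)
  also have "\<dots> = 2 * integral K (\<lambda>z. Re (wirt X z)) + integral K ?R"
    by (simp only: integral_add[OF iX iR] integral_mult_right)
  also have "\<dots> = integral K ?R"
    using integral_Re_wirt_eq_0[OF XU K(1) X0] by simp
  finally show ?thesis
    using deriv by simp
qed

section \<open>The fundamental lemma of the calculus of variations\<close>

text \<open>
  The powers of \<open>1 / x\<close> are included so that the family is closed under differentiation up to linear
  combinations.
\<close>

definition flat :: "nat \<Rightarrow> real \<Rightarrow> real" where
  "flat n x = (if 0 < x then exp (- inverse x) * inverse x ^ n else 0)"

lemma flat_tendsto_0: "(flat n \<longlongrightarrow> 0) (at 0)"
  unfolding filterlim_at_split
proof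
  have "((\<lambda>x. inverse x ^ n / exp (inverse x)) \<longlongrightarrow> 0) (at_right (0::real))"
    by (rule filterlim_compose[OF tendsto_power_div_exp_0 filterlim_inverse_at_top_right])
  then show "(flat n \<longlongrightarrow> 0) (at_right 0)"
    by (rule Lim_transform_eventually)
       (auto simp: eventually_at_filter flat_def exp_minus divide_inverse)
  show "(flat n \<longlongrightarrow> 0) (at_left 0)"
    by (rule tendsto_eventually) (auto simp: eventually_at_filter flat_def)
qed

lemma flat_has_real_derivative:
  "(flat n has_real_derivative flat (n + 2) x - of_nat n * flat (n + 1) x) (at x)"
proof (cases "x = 0")
  case True
  have "((\<lambda>h. (flat n (0 + h) - flat n 0) / h) \<longlongrightarrow> 0) (at 0)"
  proof (rule Lim_transform_eventually[OF flat_tendsto_0[of "n + 1"]])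
    show "\<forall>\<^sub>F h in at 0. flat (n + 1) h = (flat n (0 + h) - flat n 0) / h"
      by (auto simp: flat_def divide_inverse intro!: always_eventually)
  qed
  then show ?thesis
    using True by (simp add: DERIV_def) (simp add: flat_def)
next
  case False
  show ?thesis
  proof (cases "0 < x")
    case True
    have "((\<lambda>x. exp (- inverse x) * inverse x ^ n) has_real_derivative
        exp (- inverse x) * inverse x ^ 2 * inverse x ^ n
        + exp (- inverse x) * (of_nat n * inverse x ^ (n - 1) * - (inverse x ^ 2))) (at x)"
      using True by (auto intro!: derivative_eq_intros simp: power2_eq_square divide_inverse)
    moreover have "exp (- inverse x) * inverse x ^ 2 * inverse x ^ n
        + exp (- inverse x) * (of_nat n * inverse x ^ (n - 1) * - (inverse x ^ 2))
      = flat (n + 2) x - of_nat n * flat (n + 1) x"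
      using True by (cases n) (simp_all add: flat_def power_add power2_eq_square algebra_simps)
    ultimately have "((\<lambda>x. exp (- inverse x) * inverse x ^ n) has_real_derivative
        flat (n + 2) x - of_nat n * flat (n + 1) x) (at x)"
      by simp
    then show ?thesis
      by (rule has_field_derivative_transform_within_open[where S="{0<..}"])
         (use True in \<open>auto simp: flat_def\<close>)
  next
    case neg: False
    have "((\<lambda>x. 0::real) has_real_derivative flat (n + 2) x - of_nat n * flat (n + 1) x) (at x)"
      using neg by (simp add: flat_def)
    then show ?thesis
      by (rule has_field_derivative_transform_within_open[where S="{..<0}"])
         (use neg False in \<open>auto simp: flat_def\<close>)
  qed
qed

definition bump :: "nat \<Rightarrow> complex \<Rightarrow> real \<Rightarrow> complex \<Rightarrow> real" where
  "bump n a r z = flat n (r\<^sup>2 - (Re z - Re a)\<^sup>2 - (Im z - Im a)\<^sup>2)"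

text \<open>
  An algebra that contains the bump functions and all partial derivatives of its members, so smoothness
  follows by induction on the order.
\<close>

inductive_set bump_algebra :: "complex \<Rightarrow> real \<Rightarrow> (complex \<Rightarrow> real) set"
  for a :: complex and r :: real where
  const: "(\<lambda>z. c) \<in> bump_algebra a r"
| Re: "Re \<in> bump_algebra a r"
| Im: "Im \<in> bump_algebra a r"
| bump: "bump n a r \<in> bump_algebra a r"
| add: "f \<in> bump_algebra a r \<Longrightarrow> g \<in> bump_algebra a r \<Longrightarrow> (\<lambda>z. f z + g z) \<in> bump_algebra a r"
| mult: "f \<in> bump_algebra a r \<Longrightarrow> g \<in> bump_algebra a r \<Longrightarrow> (\<lambda>z. f z * g z) \<in> bump_algebra a r"

lemma bump_algebra_derivative:
  assumes "f \<in> bump_algebra a r"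
  shows "\<exists>D. (\<forall>z. (f has_derivative D z) (at z)) \<and> (\<forall>v. (\<lambda>z. D z v) \<in> bump_algebra a r)"
  using assms
proof induction
  case (const c)
  show ?case
    by (intro exI[of _ "\<lambda>z v. 0"]) (auto intro: bump_algebra.const)
next
  case Re
  show ?case
    by (intro exI[of _ "\<lambda>z. Re"])
       (auto intro: bump_algebra.const bounded_linear_imp_has_derivative bounded_linear_Re)
next
  case Im
  show ?case
    by (intro exI[of _ "\<lambda>z. Im"])
       (auto intro: bump_algebra.const bounded_linear_imp_has_derivative bounded_linear_Im)
next
  case (bump n)
  let ?s = "\<lambda>z. r\<^sup>2 - (Re z - Re a)\<^sup>2 - (Im z - Im a)\<^sup>2"
  let ?D = "\<lambda>z v. (bump (n + 2) a r z + (- of_nat n) * bump (n + 1) a r z)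
      * ((- 2 * Re v) * (Re z + - Re a) + (- 2 * Im v) * (Im z + - Im a))"
  have "(bump n a r has_derivative ?D z) (at z)" for z
  proof -
    have s: "(?s has_derivative
        (\<lambda>v. (- 2 * Re v) * (Re z + - Re a) + (- 2 * Im v) * (Im z + - Im a))) (at z)"
      by (auto intro!: derivative_eq_intros simp: algebra_simps)
    have "((\<lambda>z. flat n (?s z)) has_derivative (\<lambda>v.
        (flat (n + 2) (?s z) - of_nat n * flat (n + 1) (?s z)) *
          ((- 2 * Re v) * (Re z + - Re a) + (- 2 * Im v) * (Im z + - Im a)))) (at z)"
      by (rule has_derivative_compose[OF s flat_has_real_derivative[unfolded has_field_derivative_def]])
    then show ?thesis
      by (simp add: bump_def[abs_def])
  qed
  then show ?case
    by (intro exI[of _ ?D] conjI allI) (assumption | intro bump_algebra.intros)+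
next
  case (add f g)
  then obtain Df Dg where
    "\<And>z. (f has_derivative Df z) (at z)" "\<And>v. (\<lambda>z. Df z v) \<in> bump_algebra a r"
    "\<And>z. (g has_derivative Dg z) (at z)" "\<And>v. (\<lambda>z. Dg z v) \<in> bump_algebra a r"
    by blast
  then show ?case
    by (intro exI[of _ "\<lambda>z v. Df z v + Dg z v"]) (auto intro: has_derivative_add bump_algebra.add)
next
  case (mult f g)
  then obtain Df Dg where
    "\<And>z. (f has_derivative Df z) (at z)" "\<And>v. (\<lambda>z. Df z v) \<in> bump_algebra a r"
    "\<And>z. (g has_derivative Dg z) (at z)" "\<And>v. (\<lambda>z. Dg z v) \<in> bump_algebra a r"
    by blast
  with mult.hyps show ?case
    by (intro exI[of _ "\<lambda>z v. f z * Dg z v + Df z v * g z"] conjI allI has_derivative_mult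
          bump_algebra.add bump_algebra.mult)
qed

text \<open>
  Every directional derivative stays in the algebra, and differentiability at one order gives
  continuity at the previous one.
\<close>

lemma smooth_on_bump_algebra:
  assumes "f \<in> bump_algebra a r"
  shows "smooth_on UNIV (\<lambda>z. of_real (f z) * c :: complex)"
proof -
  have "Ck_on k UNIV (\<lambda>z. of_real (f z) * c :: complex)" if "f \<in> bump_algebra a r" for k f
    using that
  proof (induction k arbitrary: f)
    case 0
    then obtain D where "\<And>z. (f has_derivative D z) (at z)"
      using bump_algebra_derivative by blast
    then have "continuous_on UNIV f"
      by (meson continuous_at_imp_continuous_on has_derivative_continuous)
    then show ?case
      by (auto intro!: continuous_intros)
  next
    case (Suc k)
    obtain D where D: "\<And>z. (f has_derivative D z) (at z)" "\<And>v. (\<lambda>z. D z v) \<in> bump_algebra a r"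
      using bump_algebra_derivative[OF Suc.prems] by blast
    have D': "((\<lambda>z. of_real (f z) * c) has_derivative (\<lambda>v. of_real (D z v) * c)) (at z)" for z
      by (rule has_derivative_mult_left[OF has_derivative_of_real[OF D(1)]])
    have "frechet_derivative (\<lambda>z. of_real (f z) * c) (at z) v = of_real (D z v) * c" for z v
      using frechet_derivative_at[OF D'[of z]] by metis
    then show ?case
      using D' Suc.IH[OF D(2)] by (auto simp: differentiable_def)
  qed
  then show ?thesis
    using assms by (simp add: smooth_on_def)
qed

lemma bump_sum_squares: "(Re z - Re a)\<^sup>2 + (Im z - Im a)\<^sup>2 = (dist a z)\<^sup>2"
  by (simp add: dist_norm cmod_power2 power2_commute)

lemma bump_pos:
  assumes "dist a z < r"
  shows "0 < bump 0 a r z"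
proof -
  have "(dist a z)\<^sup>2 < r\<^sup>2"
    using assms by (intro power_strict_mono) auto
  then show ?thesis
    using bump_sum_squares[of z a] by (simp add: bump_def flat_def)
qed

lemma bump_eq_0:
  assumes "0 < r" "r \<le> dist a z"
  shows "bump n a r z = 0"
proof -
  have "r\<^sup>2 \<le> (dist a z)\<^sup>2"
    using assms by (intro power_mono) auto
  then show ?thesis
    using bump_sum_squares[of z a] by (simp add: bump_def flat_def)
qed

text \<open>
  If \<open>\<Gamma> a \<noteq> 0\<close>, then \<open>Re (\<Gamma> z \<Gamma>(a)\<^sup>*)\<close> is positive near \<open>a\<close>, and the variation
  \<open>\<phi> = \<Gamma>(a)\<^sup>*\<close> times a bump function at \<open>a\<close> gives a nonnegative integrand with vanishing integral.
\<close>

lemma fundamental_lemma_calculus_of_variations: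
  fixes \<Gamma> :: "complex \<Rightarrow> complex"
  assumes \<Omega>: "open \<Omega>" and \<Gamma>: "continuous_on \<Omega> \<Gamma>"
    and zero: "\<And>K \<phi>. compact K \<Longrightarrow> K \<subseteq> \<Omega> \<Longrightarrow> smooth_on UNIV \<phi> \<Longrightarrow> (\<forall>z. z \<notin> K \<longrightarrow> \<phi> z = 0) \<Longrightarrow>
      ((\<lambda>z. Re (\<Gamma> z * \<phi> z)) has_integral 0) K"
    and a: "a \<in> \<Omega>"
  shows "\<Gamma> a = 0"
proof (rule ccontr)
  assume nz: "\<Gamma> a \<noteq> 0"
  let ?f = "\<lambda>z. Re (\<Gamma> z * cnj (\<Gamma> a))"
  have contf: "continuous_on \<Omega> ?f"
    by (intro continuous_intros \<Gamma>)
  have fa: "0 < ?f a"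
    unfolding complex_norm_square[symmetric] Re_complex_of_real using nz by simp
  have op: "open {z \<in> \<Omega>. 0 < ?f z}"
  proof -
    have "{z \<in> \<Omega>. 0 < ?f z} = \<Omega> \<inter> ?f -` {0<..}"
      by blast
    then show ?thesis
      using continuous_open_preimage[OF contf \<Omega> open_greaterThan[of "0::real"]] by metis
  qed
  obtain S where S: "open S" "S \<subseteq> \<Omega>" "\<And>z. z \<in> S \<Longrightarrow> 0 < ?f z" "a \<in> S"
    using op a fa by fast
  obtain p q where pq: "cbox p q \<subseteq> S" "a \<in> box p q"
    by (rule open_contains_cbox[OF S(1,4)]) (rule that)
  obtain r where r: "0 < r" "ball a r \<subseteq> box p q"
    using pq(2) open_box[of p q] unfolding open_contains_ball by blast
  define \<phi> where "\<phi> = (\<lambda>z. of_real (bump 0 a r z) * cnj (\<Gamma> a))"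
  have smooth: "smooth_on UNIV \<phi>"
    unfolding \<phi>_def by (rule smooth_on_bump_algebra[OF bump_algebra.bump])
  have supp: "\<forall>z. z \<notin> cbox p q \<longrightarrow> \<phi> z = 0"
  proof (intro allI impI)
    fix z assume "z \<notin> cbox p q"
    then have "z \<notin> ball a r"
      using r box_subset_cbox by blast
    then show "\<phi> z = 0"
      using bump_eq_0[OF r(1), of a z 0] by (simp add: \<phi>_def)
  qed
  have eq: "Re (\<Gamma> z * \<phi> z) = bump 0 a r z * ?f z" for z
    by (simp add: \<phi>_def algebra_simps)
  have int: "((\<lambda>z. Re (\<Gamma> z * \<phi> z)) has_integral 0) (cbox p q)"
    using order_trans[OF pq(1) S(2)] by (intro zero smooth supp compact_cbox)
  have "continuous_on UNIV \<phi>"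
    using smooth by (metis smooth_on_def Ck_on.simps(1))
  then have cont: "continuous_on (cbox p q) (\<lambda>z. Re (\<Gamma> z * \<phi> z))"
    using order_trans[OF pq(1) S(2)]
    by (intro continuous_on_Re continuous_on_mult continuous_on_subset[OF \<Gamma>])
      (auto intro: continuous_on_subset)
  have "Re (\<Gamma> a * \<phi> a) = 0"
  proof (rule has_integral_0_cbox_imp_0[OF cont _ int])
    fix z assume "z \<in> box p q"
    then have "0 < ?f z"
      using pq(1) box_subset_cbox[of p q] by (intro S(3)) blast
    moreover have "0 \<le> bump 0 a r z"
      by (simp add: bump_def flat_def)
    ultimately show "0 \<le> Re (\<Gamma> z * \<phi> z)"
      unfolding eq by (intro mult_nonneg_nonneg) auto
  next
    show "a \<in> cbox p q"
      by (rule subsetD[OF box_subset_cbox pq(2)])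
    show "box p q \<noteq> {}"
      using pq(2) by (metis empty_iff)
  qed
  moreover have "0 < bump 0 a r a"
    using bump_pos r by simp
  ultimately show False
    unfolding eq using mult_pos_pos[OF _ fa] by (metis less_irrefl)
qed

section \<open>Radial functions in the plane\<close>

lemma open_annulus:
  assumes "open I"
  shows "open (annulus I)"
proof -
  have "annulus I = cmod -` I"
    by (auto simp: annulus_def)
  then show ?thesis
    using continuous_open_vimage[OF assms, of cmod] by (simp add: continuous_intros)
qed

lemma radial_has_derivative:
  fixes f :: "real \<Rightarrow> 'b::real_normed_vector"
  assumes "(f has_vector_derivative f') (at (cmod z))" "z \<noteq> 0"
  shows "((\<lambda>z. f (cmod z)) has_derivative (\<lambda>v. (v \<bullet> sgn z) *\<^sub>R f')) (at z)"
  using has_derivative_compose[OF has_derivative_norm[OF assms(2)] assms(1)[unfolded has_vector_derivative_def]]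
  by (simp add: inner_commute)

lemma C1_on_radial:
  fixes f :: "real \<Rightarrow> 'b::real_normed_vector"
  assumes "I \<subseteq> {0<..}" "\<And>R. R \<in> I \<Longrightarrow> (f has_vector_derivative f1 R) (at R)" "continuous_on I f1"
  shows "Ck_on 1 (annulus I) (\<lambda>z. f (cmod z))"
proof (rule C1_onI)
  show "((\<lambda>z. f (cmod z)) has_derivative (\<lambda>v. (v \<bullet> sgn z) *\<^sub>R f1 (cmod z))) (at z)" if "z \<in> annulus I" for z
    using that assms by (intro radial_has_derivative) (auto simp: annulus_def)
  have "continuous_on (annulus I) (\<lambda>z. f1 (cmod z))"
    by (rule continuous_on_compose2[OF assms(3)]) (auto simp: annulus_def intro: continuous_on_norm_id)
  moreover have "continuous_on (annulus I) sgn"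
    using assms(1) unfolding sgn_div_norm[abs_def] by (intro continuous_intros ballI) (auto simp: annulus_def)
  ultimately show "continuous_on (annulus I) (\<lambda>z. (v \<bullet> sgn z) *\<^sub>R f1 (cmod z))" for v
    by (intro continuous_on_scaleR continuous_on_inner continuous_on_const)
qed

text \<open>
  The Wirtinger derivative of \<open>R\<close> is \<open>\<xi>\<^sup>* / (2 R)\<close>.
\<close>

lemma wirt_radial:
  fixes f :: "real \<Rightarrow> complex"
  assumes "(f has_vector_derivative f') (at (cmod z))" "z \<noteq> 0"
  shows "wirt (\<lambda>z. f (cmod z)) z = cnj z / of_real (2 * cmod z) * f'"
proof -
  have "1 \<bullet> sgn z = Re z / cmod z" "\<i> \<bullet> sgn z = Im z / cmod z"
    by (simp_all add: inner_complex_def sgn_div_norm divide_inverse)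
  then have "wirt (\<lambda>z. f (cmod z)) z = (of_real (Re z / cmod z) - \<i> * of_real (Im z / cmod z)) * f' / 2"
    unfolding wirt_eq[OF radial_has_derivative[OF assms]] by (simp add: scaleR_conv_of_real algebra_simps)
  also have "of_real (Re z / cmod z) - \<i> * of_real (Im z / cmod z) = cnj z / of_real (cmod z)"
    by (simp add: complex_eq_iff)
  finally show ?thesis by simp
qed

lemma wirt_ident: "wirt (\<lambda>z. z) z = 1"
  by (subst wirt_eq[OF has_derivative_ident]) simp

lemma wirt_cnj: "wirt cnj z = 0"
  by (subst wirt_eq[OF bounded_linear_imp_has_derivative[OF bounded_linear_cnj]]) simp

lemma has_derivative_inverse_cnj:
  assumes "z \<noteq> 0"
  shows "((\<lambda>z. inverse (cnj z)) has_derivative (\<lambda>v. - (inverse (cnj z) * cnj v * inverse (cnj z)))) (at z)"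
  using assms
  by (intro Deriv.has_derivative_inverse[where f=cnj, OF _ bounded_linear_imp_has_derivative[OF bounded_linear_cnj]]) simp

lemma C1_on_inverse_cnj:
  assumes "0 \<notin> S"
  shows "Ck_on 1 S (\<lambda>z. inverse (cnj z))"
proof (rule C1_onI)
  show "((\<lambda>z. inverse (cnj z)) has_derivative (\<lambda>v. - (inverse (cnj z) * cnj v * inverse (cnj z)))) (at z)"
    if "z \<in> S" for z
    using assms that by (intro has_derivative_inverse_cnj) auto
  show "continuous_on S (\<lambda>z. - (inverse (cnj z) * cnj v * inverse (cnj z)))" for v
    using assms by (intro continuous_intros) auto
qed

text \<open>
  Antiholomorphic factors are constants for \<open>\<partial>\<close>; this is why \<open>\<tau>\<close> is later written as a radial
  function divided by \<open>(\<xi>\<^sup>*)\<^sup>2\<close>.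
\<close>

lemma wirt_inverse_cnj: "z \<noteq> 0 \<Longrightarrow> wirt (\<lambda>z. inverse (cnj z)) z = 0"
  by (subst wirt_eq[OF has_derivative_inverse_cnj]) (auto simp: algebra_simps)

lemma wirt_cong:
  assumes "open \<Omega>" "z \<in> \<Omega>" "\<And>z. z \<in> \<Omega> \<Longrightarrow> f z = g z"
  shows "wirt f z = wirt g z"
proof -
  have "(f has_derivative D) (at z) \<longleftrightarrow> (g has_derivative D) (at z)" for D
    using assms has_derivative_transform_within_open[of f D z UNIV \<Omega> g]
      has_derivative_transform_within_open[of g D z UNIV \<Omega> f] by auto
  then show ?thesis
    by (simp add: wirt_def frechet_derivative_def)
qed

lemma Complex_vector_derivative:
  assumes "(f has_real_derivative f') (at R)" "(g has_real_derivative g') (at R)"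
  shows "((\<lambda>R. Complex (f R) (g R)) has_vector_derivative Complex f' g') (at R)"
  using assms by (simp add: has_vector_derivative_complex_iff)

lemma of_real_vector_derivative:
  assumes "(f has_real_derivative f') (at R)"
  shows "((\<lambda>R. complex_of_real (f R)) has_vector_derivative of_real f') (at R)"
  using assms by (simp add: has_vector_derivative_complex_iff)

section \<open>The metric coefficients of a rotationally symmetric graph\<close>

lemma real_derivative_continuous_on:
  fixes f :: "real \<Rightarrow> real"
  assumes "\<And>R. R \<in> I \<Longrightarrow> (f has_real_derivative f1 R) (at R)"
  shows "continuous_on I f"
  using assms by (meson DERIV_continuous_on has_field_derivative_at_within)

text \<open>
  Radial data of a graph \<open>F = \<xi> (h + i p)\<close>, together with their first two derivatives.  Two derivatives
  are exactly what the Euler-Lagrange expression involves.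
\<close>

locale rotational_graph =
  fixes I :: "real set" and u u1 u2 h h1 h2 p p1 p2 :: "real \<Rightarrow> real" and F :: "complex \<Rightarrow> complex"
  assumes open_I: "open I" and interval_I: "is_interval I" and pos_I: "I \<subseteq> {0<..}"
    and u: "\<And>R. R \<in> I \<Longrightarrow> (u has_real_derivative u1 R) (at R)"
      "\<And>R. R \<in> I \<Longrightarrow> (u1 has_real_derivative u2 R) (at R)" "continuous_on I u2"
    and h: "\<And>R. R \<in> I \<Longrightarrow> (h has_real_derivative h1 R) (at R)"
      "\<And>R. R \<in> I \<Longrightarrow> (h1 has_real_derivative h2 R) (at R)" "continuous_on I h2"
    and p: "\<And>R. R \<in> I \<Longrightarrow> (p has_real_derivative p1 R) (at R)"
      "\<And>R. R \<in> I \<Longrightarrow> (p1 has_real_derivative p2 R) (at R)" "continuous_on I p2"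
    and F_eq: "\<And>z. z \<in> annulus I \<Longrightarrow> F z = z * Complex (h (cmod z)) (p (cmod z))"
begin

abbreviation U :: "complex \<Rightarrow> real" where "U \<equiv> \<lambda>z. u (cmod z)"

text \<open>
  Up to a constant, \<open>\<surd>w\<close> is the length of the circle of radius \<open>R\<close> in the metric \<open>g\<close>.
\<close>

definition w where "w R = R\<^sup>2 * exp (2 * u R)"
definition w1 where "w1 R = (2 * R + 2 * R\<^sup>2 * u1 R) * exp (2 * u R)"
definition w2 where "w2 R = (2 + 8 * R * u1 R + 2 * R\<^sup>2 * u2 R + 4 * R\<^sup>2 * (u1 R)\<^sup>2) * exp (2 * u R)"

text \<open>
  The expanded form of \<open>w' (w p\<^sup>2)' - (w h')\<^sup>2\<close>, four times the discriminant in the variables \<open>w, h, p\<close> up to the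
  factor \<open>R\<^sup>2 / w\<^sup>2\<close>.
\<close>

definition S where "S R = (w1 R)\<^sup>2 * (p R)\<^sup>2 + 2 * w R * w1 R * p R * p1 R - (w R)\<^sup>2 * (h1 R)\<^sup>2"
definition S1 where "S1 R = 2 * w1 R * w2 R * (p R)\<^sup>2 + 4 * (w1 R)\<^sup>2 * p R * p1 R + 2 * w R * w2 R * p R * p1 R
   + 2 * w R * w1 R * (p1 R)\<^sup>2 + 2 * w R * w1 R * p R * p2 R
   - 2 * w R * w1 R * (h1 R)\<^sup>2 - 2 * (w R)\<^sup>2 * h1 R * h2 R"

lemma w_derivative: "R \<in> I \<Longrightarrow> (w has_real_derivative w1 R) (at R)"
  unfolding w_def[abs_def] w1_def
  by (auto intro!: derivative_eq_intros u simp: power2_eq_square algebra_simps)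

lemma w1_derivative: "R \<in> I \<Longrightarrow> (w1 has_real_derivative w2 R) (at R)"
  unfolding w2_def w1_def[abs_def]
  by (auto intro!: derivative_eq_intros u simp: power2_eq_square algebra_simps)

lemma w_pos: "R \<in> I \<Longrightarrow> 0 < w R"
  using pos_I by (auto simp: w_def)

lemma S_derivative: "R \<in> I \<Longrightarrow> (S has_real_derivative S1 R) (at R)"
  unfolding S_def[abs_def] S1_def
  by (auto intro!: derivative_eq_intros w_derivative w1_derivative h p simp: power2_eq_square algebra_simps)

lemma cont_u: "continuous_on I u" "continuous_on I u1"
  using real_derivative_continuous_on u by blast+

lemma cont_hp: "continuous_on I h" "continuous_on I h1" "continuous_on I p" "continuous_on I p1"
  using real_derivative_continuous_on h p by blast+

lemma cont_w: "continuous_on I w" "continuous_on I w1" "continuous_on I w2"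
  unfolding w_def[abs_def] w1_def[abs_def] w2_def[abs_def]
  by (intro continuous_intros cont_u u)+

lemma cont_S: "continuous_on I S" "continuous_on I S1"
  unfolding S_def[abs_def] S1_def[abs_def]
  by (intro continuous_intros cont_w cont_hp h p)+

lemma zero_notin_annulus: "0 \<notin> annulus I"
  using pos_I by (auto simp: annulus_def)

lemma sigma_F:
  assumes z: "z \<in> annulus I"
  shows "sigma F z = - (cnj z)\<^sup>2 / of_real (2 * cmod z) * Complex (h1 (cmod z)) (- p1 (cmod z))"
proof -
  have z0: "z \<noteq> 0" and R: "cmod z \<in> I"
    using z zero_notin_annulus by (auto simp: annulus_def)
  let ?g = "\<lambda>R. Complex (h R) (- p R)"
  have g: "(?g has_vector_derivative Complex (h1 (cmod z)) (- p1 (cmod z))) (at (cmod z))"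
    by (intro Complex_vector_derivative h p DERIV_minus R)
  have "wirt (\<lambda>z. cnj (F z)) z = wirt (\<lambda>z. cnj z * ?g (cmod z)) z"
    by (rule wirt_cong[OF open_annulus[OF open_I] z]) (simp add: F_eq complex_eq_iff)
  also have "\<dots> = cnj z * (cnj z / of_real (2 * cmod z) * Complex (h1 (cmod z)) (- p1 (cmod z)))"
    using wirt_mult[of cnj z "\<lambda>z. ?g (cmod z)"] radial_has_derivative[OF g z0] wirt_radial[OF g z0]
      bounded_linear_imp_differentiable[OF bounded_linear_cnj]
    by (auto simp: wirt_cnj differentiable_def)
  finally show ?thesis
    by (simp add: sigma_def power2_eq_square)
qed

text \<open>
  In terms of \<open>w\<close> this is \<open>R (w p)' / (2 w)\<close>, since \<open>w' = 2 R e\<^sup>2\<^sup>u (1 + R u')\<close>.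
\<close>

lemma lambda_F:
  assumes z: "z \<in> annulus I"
  shows "lambda U F z = cmod z / (2 * w (cmod z)) * (w1 (cmod z) * p (cmod z) + w (cmod z) * p1 (cmod z))"
proof -
  define R where "R = cmod z"
  have z0: "z \<noteq> 0" and R: "R \<in> I" and R0: "0 < R"
    using z zero_notin_annulus by (auto simp: annulus_def R_def)
  let ?g = "\<lambda>R. Complex (h R * exp (2 * u R)) (p R * exp (2 * u R))"
  let ?g1 = "Complex ((h1 R + 2 * u1 R * h R) * exp (2 * u R)) ((p1 R + 2 * u1 R * p R) * exp (2 * u R))"
  have g: "(?g has_vector_derivative ?g1) (at (cmod z))"
    unfolding R_def[symmetric]
    by (intro Complex_vector_derivative) (auto intro!: derivative_eq_intros h p u R simp: algebra_simps)
  have "wirt (\<lambda>z. F z * of_real (exp (2 * U z))) z = wirt (\<lambda>z. z * ?g (cmod z)) z"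
    by (rule wirt_cong[OF open_annulus[OF open_I] z]) (simp add: F_eq complex_eq_iff algebra_simps)
  also have "\<dots> = ?g R + z * (cnj z / of_real (2 * R) * ?g1)"
    using wirt_mult[of "\<lambda>z. z" z "\<lambda>z. ?g (cmod z)"] radial_has_derivative[OF g z0] wirt_radial[OF g z0]
    by (auto simp: wirt_ident differentiable_def R_def)
  also have "z * (cnj z / of_real (2 * R) * ?g1) = of_real (R / 2) * ?g1"
    using R0 complex_norm_square[of z] by (simp add: R_def power2_eq_square field_simps)
  finally have "lambda U F z = exp (- 2 * u R) * (p R * exp (2 * u R) + R / 2 * ((p1 R + 2 * u1 R * p R) * exp (2 * u R)))"
    by (simp add: lambda_def R_def[symmetric])
  also have "\<dots> = (exp (- 2 * u R) * exp (2 * u R)) * (p R + R / 2 * (p1 R + 2 * u1 R * p R))"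
    by (simp add: algebra_simps)
  also have "exp (- 2 * u R) * exp (2 * u R) = 1"
    by (simp flip: exp_add)
  also have "1 * (p R + R / 2 * (p1 R + 2 * u1 R * p R)) = R / (2 * w R) * (w1 R * p R + w R * p1 R)"
    using R0 by (simp add: w_def w1_def field_simps power2_eq_square)
  finally show ?thesis by (simp add: R_def)
qed

text \<open>
  The squares of \<open>w p'\<close> cancel, and what remains is linear in \<open>p'\<close>; this is what makes \<open>w p\<^sup>2\<close> a good variable.
\<close>

lemma discriminant_F:
  assumes z: "z \<in> annulus I"
  shows "(lambda U F z)\<^sup>2 - (cmod (sigma F z))\<^sup>2 = (cmod z / (2 * w (cmod z)))\<^sup>2 * S (cmod z)"
proof -
  define R where "R = cmod z"
  have R: "R \<in> I" and R0: "0 < R"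
    using z zero_notin_annulus by (auto simp: annulus_def R_def)
  have "cmod (sigma F z) = R / 2 * cmod (Complex (h1 R) (- p1 R))"
    using R0 by (simp add: sigma_F[OF z] norm_mult norm_divide norm_power R_def power2_eq_square)
  then have "(cmod (sigma F z))\<^sup>2 = (R / 2)\<^sup>2 * ((h1 R)\<^sup>2 + (p1 R)\<^sup>2)"
    by (simp only: power_mult_distrib) (simp add: cmod_power2)
  then show ?thesis
    using w_pos[OF R]
    by (simp add: lambda_F[OF z] S_def R_def[symmetric] field_simps power2_eq_square)
qed

end

section \<open>The Euler-Lagrange equations of rotationally symmetric graphs\<close>

text \<open>
  The constant \<open>s\<close> is the sign of \<open>S\<close>: the induced metric is definite for \<open>s = 1\<close> and Lorentzian for
  \<open>s = -1\<close>.
\<close>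

locale nondegenerate_rotational_graph = rotational_graph +
  fixes s :: real
  assumes s: "s = 1 \<or> s = -1" and sS_pos: "\<And>R. R \<in> I \<Longrightarrow> 0 < s * S R"
begin

definition L where "L R = sqrt (s * S R)"
definition L1 where "L1 R = s * S1 R / (2 * L R)"

lemma L_pos: "R \<in> I \<Longrightarrow> 0 < L R"
  using sS_pos by (simp add: L_def)

lemma L_square: "R \<in> I \<Longrightarrow> (L R)\<^sup>2 = s * S R"
  using sS_pos[of R] by (simp add: L_def)

lemma L_derivative: "R \<in> I \<Longrightarrow> (L has_real_derivative L1 R) (at R)"
  unfolding L_def[abs_def] L1_def
  using sS_pos[of R] by (auto intro!: derivative_eq_intros S_derivative simp: field_simps)

lemma cont_L: "continuous_on I L" "continuous_on I L1"
proof -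
  show L: "continuous_on I L"
    unfolding L_def[abs_def] by (intro continuous_intros cont_S)
  show "continuous_on I L1"
    unfolding L1_def[abs_def] using L_pos
    by (intro continuous_on_divide continuous_on_mult continuous_on_const cont_S L) force
qed

text \<open>
  \<open>\<kappa>\<close> and \<open>M\<close> are the momenta conjugate to \<open>h\<close> and \<open>w p\<^sup>2\<close>, up to sign and scaling; \<open>\<mu>\<close> splits \<open>(w p)' / L\<close> as \<open>M p + \<mu>\<close>.
\<close>

definition \<kappa> where "\<kappa> R = (w R)\<^sup>2 * h1 R / L R"
definition \<kappa>1 where "\<kappa>1 R = ((2 * w R * w1 R * h1 R + (w R)\<^sup>2 * h2 R) * L R - (w R)\<^sup>2 * h1 R * L1 R) / (L R)\<^sup>2"
definition M where "M R = w1 R / L R"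
definition M1 where "M1 R = (w2 R * L R - w1 R * L1 R) / (L R)\<^sup>2"
definition \<mu> where "\<mu> R = w R * p1 R / L R"
definition \<mu>1 where "\<mu>1 R = ((w1 R * p1 R + w R * p2 R) * L R - w R * p1 R * L1 R) / (L R)\<^sup>2"

lemma quotient_derivative:
  assumes "R \<in> I" "(f has_real_derivative f1) (at R)"
  shows "((\<lambda>R. f R / L R) has_real_derivative (f1 * L R - f R * L1 R) / (L R)\<^sup>2) (at R)"
  using DERIV_divide[OF assms(2) L_derivative[OF assms(1)]] L_pos[OF assms(1)]
  by (simp add: power2_eq_square)

lemma \<kappa>_derivative: "R \<in> I \<Longrightarrow> (\<kappa> has_real_derivative \<kappa>1 R) (at R)"
  unfolding \<kappa>_def[abs_def] \<kappa>1_def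
  by (rule quotient_derivative) (auto intro!: derivative_eq_intros w_derivative h simp: algebra_simps)

lemma M_derivative: "R \<in> I \<Longrightarrow> (M has_real_derivative M1 R) (at R)"
  unfolding M_def[abs_def] M1_def by (rule quotient_derivative) (auto intro: w1_derivative)

lemma \<mu>_derivative: "R \<in> I \<Longrightarrow> (\<mu> has_real_derivative \<mu>1 R) (at R)"
  unfolding \<mu>_def[abs_def] \<mu>1_def
  by (rule quotient_derivative) (auto intro!: derivative_eq_intros w_derivative p simp: algebra_simps)

lemma cont_quotient: "continuous_on I f \<Longrightarrow> continuous_on I (\<lambda>R. f R / (L R)\<^sup>2)" for f :: "real \<Rightarrow> real"
  using L_pos by (intro continuous_on_divide continuous_on_power cont_L) force+

lemma cont_\<kappa>M\<mu>: "continuous_on I \<kappa>1" "continuous_on I M1" "continuous_on I \<mu>1"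
  unfolding \<kappa>1_def[abs_def] M1_def[abs_def] \<mu>1_def[abs_def]
  by (intro cont_quotient continuous_on_add continuous_on_diff continuous_on_mult continuous_on_power
      continuous_on_const cont_w cont_hp cont_L h p)+

definition l :: "complex \<Rightarrow> complex" where
  "l z = of_real (s * (M (cmod z) * p (cmod z) + \<mu> (cmod z)))"
definition \<tau> :: "complex \<Rightarrow> complex" where
  "\<tau> z = Complex (- s * \<kappa> (cmod z)) (- s * (w (cmod z) * \<mu> (cmod z))) * (inverse (cnj z) * inverse (cnj z))"

lemma l_radial_derivative:
  "R \<in> I \<Longrightarrow> ((\<lambda>R. complex_of_real (s * (M R * p R + \<mu> R))) has_vector_derivative
      of_real (s * (M1 R * p R + M R * p1 R + \<mu>1 R))) (at R)"
  by (intro of_real_vector_derivative)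
     (auto intro!: derivative_eq_intros M_derivative \<mu>_derivative p simp: algebra_simps)

lemma \<tau>_radial_derivative:
  "R \<in> I \<Longrightarrow> ((\<lambda>R. Complex (- s * \<kappa> R) (- s * (w R * \<mu> R))) has_vector_derivative
      Complex (- s * \<kappa>1 R) (- s * (w1 R * \<mu> R + w R * \<mu>1 R))) (at R)"
  by (intro Complex_vector_derivative)
     (auto intro!: derivative_eq_intros \<kappa>_derivative w_derivative \<mu>_derivative simp: algebra_simps)

lemma cont_M_\<mu>: "continuous_on I M" "continuous_on I \<mu>"
  using real_derivative_continuous_on M_derivative \<mu>_derivative by blast+

lemma C1_l: "Ck_on 1 (annulus I) l"
  unfolding l_def[abs_def]
  by (rule C1_on_radial[OF pos_I l_radial_derivative])
     (auto intro!: continuous_on_of_real continuous_on_mult continuous_on_add continuous_on_const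
        cont_M_\<mu> cont_hp cont_\<kappa>M\<mu>)

lemma C1_\<tau>: "Ck_on 1 (annulus I) \<tau>"
  unfolding \<tau>_def[abs_def]
  by (intro C1_on_mult C1_on_inverse_cnj zero_notin_annulus C1_on_radial[OF pos_I \<tau>_radial_derivative])
     (auto simp: Complex_eq intro!: continuous_on_of_real continuous_on_mult continuous_on_add
        continuous_on_minus continuous_on_diff continuous_on_const cont_w cont_M_\<mu> cont_hp cont_\<kappa>M\<mu>)

lemma wirt_l:
  assumes z: "z \<in> annulus I"
  shows "wirt l z = cnj z / of_real (2 * cmod z) * of_real (s * (M1 (cmod z) * p (cmod z) + M (cmod z) * p1 (cmod z) + \<mu>1 (cmod z)))"
  unfolding l_def[abs_def]
  by (rule wirt_radial[OF l_radial_derivative]) (use z zero_notin_annulus in \<open>auto simp: annulus_def\<close>)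

lemma wirt_\<tau>:
  assumes z: "z \<in> annulus I"
  shows "wirt \<tau> z = cnj z / of_real (2 * cmod z) *
     Complex (- s * \<kappa>1 (cmod z)) (- s * (w1 (cmod z) * \<mu> (cmod z) + w (cmod z) * \<mu>1 (cmod z)))
       * (inverse (cnj z) * inverse (cnj z))"
proof -
  have z0: "z \<noteq> 0" and R: "cmod z \<in> I"
    using z zero_notin_annulus by (auto simp: annulus_def)
  have i: "(\<lambda>z. inverse (cnj z)) differentiable (at z)"
    using has_derivative_inverse_cnj[OF z0] unfolding differentiable_def by blast
  have r: "(\<lambda>z. Complex (- s * \<kappa> (cmod z)) (- s * (w (cmod z) * \<mu> (cmod z)))) differentiable (at z)"
    using radial_has_derivative[OF \<tau>_radial_derivative[OF R] z0] unfolding differentiable_def by blast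
  show ?thesis
    unfolding \<tau>_def[abs_def] wirt_mult[OF r differentiable_mult[OF i i]] wirt_mult[OF i i]
      wirt_inverse_cnj[OF z0] wirt_radial[OF \<tau>_radial_derivative[OF R] z0] by simp
qed

text \<open>
  With \<open>\<xi>\<^sup>* / R\<^sup>2 = 1 / \<xi>\<close> both terms acquire the factor \<open>s / (2 R \<xi>)\<close>.  In the imaginary part
  \<open>w M p' = w' \<mu>\<close> cancels all terms except \<open>w p M'\<close>.
\<close>

lemma euler_lagrange:
  assumes z: "z \<in> annulus I"
  shows "\<i> * of_real (exp (2 * U z)) * wirt l z - cnj (wirt \<tau> z)
    = of_real s / (of_real (2 * cmod z) * z) * Complex (\<kappa>1 (cmod z)) (w (cmod z) * p (cmod z) * M1 (cmod z))"
proof -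
  define R where "R = cmod z"
  have z0: "z \<noteq> 0" and R: "R \<in> I" and R0: "R \<noteq> 0"
    using z zero_notin_annulus by (auto simp: annulus_def R_def)
  have e: "of_real (exp (2 * u R)) * cnj z = of_real (w R) / z"
    using z0 R0 complex_norm_square[of z] by (simp add: w_def R_def field_simps power2_eq_square)
  have c: "w R * (M R * p1 R) = w1 R * \<mu> R"
    by (simp add: M_def \<mu>_def)
  have "\<i> * of_real (exp (2 * U z)) * wirt l z
      = \<i> * (of_real (exp (2 * u R)) * cnj z) * of_real (s * (M1 R * p R + M R * p1 R + \<mu>1 R)) / of_real (2 * R)"
    by (simp add: wirt_l[OF z] R_def)
  also have "\<dots> = \<i> * of_real s * of_real (w R * (M1 R * p R) + w1 R * \<mu> R + w R * \<mu>1 R) / (of_real (2 * R) * z)"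
    unfolding e c[symmetric] using z0 R0 by (simp add: field_simps)
  finally have 1: "\<i> * of_real (exp (2 * U z)) * wirt l z
      = \<i> * of_real s * of_real (w R * (M1 R * p R) + w1 R * \<mu> R + w R * \<mu>1 R) / (of_real (2 * R) * z)" .
  have 2: "cnj (wirt \<tau> z) = - of_real s * cnj (Complex (\<kappa>1 R) (w1 R * \<mu> R + w R * \<mu>1 R)) / (of_real (2 * R) * z)"
    using z0 R0 by (simp add: wirt_\<tau>[OF z] R_def[symmetric] Complex_eq field_simps)
  show ?thesis
    unfolding 1 2 unfolding R_def[symmetric] using z0 R0 by (simp add: Complex_eq field_simps)
qed

lemma sqrt_discriminant:
  assumes z: "z \<in> annulus I"
  defines "D \<equiv> (lambda U F z)\<^sup>2 - (cmod (sigma F z))\<^sup>2"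
  shows "sgn D = s" "sqrt \<bar>D\<bar> = cmod z * L (cmod z) / (2 * w (cmod z))"
proof -
  define R where "R = cmod z"
  have R: "R \<in> I" and R0: "0 < R"
    using z zero_notin_annulus by (auto simp: annulus_def R_def)
  define q where "q = R / (2 * w R)"
  have D: "D = q\<^sup>2 * S R"
    unfolding D_def R_def q_def by (rule discriminant_F[OF z])
  have q: "0 < q"
    using R0 w_pos[OF R] by (simp add: q_def)
  have sgnS: "sgn (S R) = s" and absS: "\<bar>S R\<bar> = s * S R"
    using s sS_pos[OF R] by (auto simp: sgn_if)
  show "sgn D = s"
    by (simp only: D sgn_mult sgn_pos[OF zero_less_power[OF q]] sgnS mult_1)
  have "sqrt \<bar>D\<bar> = q * L R"
    using q by (simp add: D abs_mult absS real_sqrt_mult L_def)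
  then show "sqrt \<bar>D\<bar> = cmod z * L (cmod z) / (2 * w (cmod z))"
    by (simp add: q_def R_def)
qed

lemma l_eq:
  assumes z: "z \<in> annulus I"
  shows "l z = of_real (sgn ((lambda U F z)\<^sup>2 - (cmod (sigma F z))\<^sup>2) * lambda U F z
      / sqrt \<bar>(lambda U F z)\<^sup>2 - (cmod (sigma F z))\<^sup>2\<bar>)"
proof -
  define R where "R = cmod z"
  have R: "R \<in> I" and R0: "0 < R"
    using z zero_notin_annulus by (auto simp: annulus_def R_def)
  show ?thesis
    unfolding sqrt_discriminant[OF z] unfolding lambda_F[OF z] l_def of_real_eq_iff R_def[symmetric]
    using R0 w_pos[OF R] L_pos[OF R] by (simp add: M_def \<mu>_def field_simps)
qed

lemma \<tau>_eq:
  assumes z: "z \<in> annulus I"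
  shows "\<tau> z = of_real (exp (2 * U z) * sgn ((lambda U F z)\<^sup>2 - (cmod (sigma F z))\<^sup>2)
      / sqrt \<bar>(lambda U F z)\<^sup>2 - (cmod (sigma F z))\<^sup>2\<bar>) * cnj (sigma F z)"
proof -
  define R where "R = cmod z"
  have z0: "z \<noteq> 0" and R: "R \<in> I" and R0: "0 < R"
    using z zero_notin_annulus by (auto simp: annulus_def R_def)
  have zz: "inverse (cnj z) = z / of_real (R\<^sup>2)"
    using z0 R0 complex_norm_square[of z] by (simp add: R_def field_simps)
  have e: "exp (2 * u R) = w R / R\<^sup>2"
    using R0 by (simp add: w_def)
  have k: "Complex (- s * \<kappa> R) (- s * (w R * \<mu> R)) = of_real (- s * (w R)\<^sup>2 / L R) * Complex (h1 R) (p1 R)"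
    by (simp add: complex_eq_iff \<kappa>_def \<mu>_def power2_eq_square)
  have c: "cnj (Complex (h1 R) (- p1 R)) = Complex (h1 R) (p1 R)"
    by (simp add: complex_eq_iff)
  show ?thesis
    unfolding sqrt_discriminant[OF z] unfolding sigma_F[OF z] \<tau>_def R_def[symmetric] zz e k
      complex_cnj_mult complex_cnj_minus complex_cnj_divide complex_cnj_power complex_cnj_cnj c complex_cnj_complex_of_real
    using R0 w_pos[OF R] L_pos[OF R] by (simp add: field_simps power2_eq_square)
qed

text \<open>
  The multiplier \<open>\<Gamma>\<close> of the variation in the first variation formula vanishes identically exactly when
  its real and imaginary radial parts do.
\<close>

theorem area_stationary_iff:
  assumes F: "Ck_on 1 (annulus I) F"
  shows "area_stationary U (annulus I) F \<longleftrightarrow> (\<forall>R\<in>I. \<kappa>1 R = 0 \<and> p R * M1 R = 0)"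
proof -
  let ?\<Gamma> = "\<lambda>z. \<i> * of_real (exp (2 * U z)) * wirt l z - cnj (wirt \<tau> z)"
  have U: "Ck_on 1 (annulus I) U"
    by (rule C1_on_radial[OF pos_I _ cont_u(2)]) (use u in \<open>simp add: has_real_derivative_iff_has_vector_derivative\<close>)
  have D0: "(lambda U F z)\<^sup>2 - (cmod (sigma F z))\<^sup>2 \<noteq> 0" if "z \<in> annulus I" for z
    using sqrt_discriminant(1)[OF that] s by auto
  have variation: "((\<lambda>t. graph_area U K (\<lambda>z. F z + of_real t * \<phi> z)) has_real_derivative
      integral K (\<lambda>z. 2 * Re (?\<Gamma> z * \<phi> z))) (at 0)"
    if "compact K" "K \<subseteq> annulus I" "smooth_on UNIV \<phi>" "\<forall>z. z \<notin> K \<longrightarrow> \<phi> z = 0" for K and \<phi> :: "complex \<Rightarrow> complex"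
    using that
    by (intro first_variation_of_area[OF open_annulus[OF open_I] _ _ U F _ _ D0 C1_l l_eq C1_\<tau> \<tau>_eq])
       (auto simp: smooth_on_def simp del: Ck_on.simps)
  have cont: "continuous_on (annulus I) ?\<Gamma>"
    by (intro continuous_on_diff continuous_on_mult continuous_on_const continuous_on_cnj
        continuous_on_wirt C1_on_continuous[OF C1_on_exp] U C1_l C1_\<tau>)
  show ?thesis
  proof
    assume stat: "area_stationary U (annulus I) F"
    have zero: "((\<lambda>z. Re (?\<Gamma> z * \<phi> z)) has_integral 0) K"
      if K: "compact K" "K \<subseteq> annulus I" and \<phi>: "smooth_on UNIV \<phi>" "\<forall>z. z \<notin> K \<longrightarrow> \<phi> z = 0" for K and \<phi> :: "complex \<Rightarrow> complex"
    proof -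
      have "continuous_on UNIV \<phi>"
        using \<phi>(1) by (metis smooth_on_def Ck_on.simps(1))
      then have "continuous_on K (\<lambda>z. Re (?\<Gamma> z * \<phi> z))"
        by (intro continuous_on_Re continuous_on_mult continuous_on_subset[OF cont K(2)])
           (auto intro: continuous_on_subset)
      then have int: "(\<lambda>z. Re (?\<Gamma> z * \<phi> z)) integrable_on K"
        by (rule integrable_on_compact[OF K(1)])
      have "((\<lambda>t. graph_area U K (\<lambda>z. F z + of_real t * \<phi> z)) has_real_derivative 0) (at 0)"
        using stat that unfolding area_stationary_def by blast
      then have "integral K (\<lambda>z. 2 * Re (?\<Gamma> z * \<phi> z)) = 0"
        by (rule DERIV_unique[OF variation[OF that]])
      then have "integral K (\<lambda>z. Re (?\<Gamma> z * \<phi> z)) = 0"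
        by (simp only: integral_mult_right mult_eq_0_iff) simp
      then show ?thesis
        using integrable_integral[OF int] by simp
    qed
    show "\<forall>R\<in>I. \<kappa>1 R = 0 \<and> p R * M1 R = 0"
    proof
      fix R assume R: "R \<in> I"
      then have R0: "0 < R" using pos_I by auto
      have z: "complex_of_real R \<in> annulus I"
        using R R0 by (simp add: annulus_def)
      have "?\<Gamma> (of_real R) = 0"
        by (rule fundamental_lemma_calculus_of_variations[OF open_annulus[OF open_I] cont zero z])
      then have "Complex (\<kappa>1 R) (w R * p R * M1 R) = 0"
        using R0 s unfolding euler_lagrange[OF z] by auto
      then show "\<kappa>1 R = 0 \<and> p R * M1 R = 0"
        using w_pos[OF R] by (simp add: complex_eq_iff)
    qed
  next
    assume eq: "\<forall>R\<in>I. \<kappa>1 R = 0 \<and> p R * M1 R = 0"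
    have \<Gamma>0: "?\<Gamma> z = 0" if "z \<in> annulus I" for z
    proof -
      have "Complex (\<kappa>1 (cmod z)) (w (cmod z) * p (cmod z) * M1 (cmod z)) = 0"
        using eq that by (auto simp: annulus_def complex_eq_iff)
      then show ?thesis
        unfolding euler_lagrange[OF that] by simp
    qed
    show "area_stationary U (annulus I) F"
      unfolding area_stationary_def
    proof (intro allI impI, elim conjE)
      fix K and \<phi> :: "complex \<Rightarrow> complex"
      assume K: "compact K" "K \<subseteq> annulus I" and \<phi>: "smooth_on UNIV \<phi>" "\<forall>z. z \<notin> K \<longrightarrow> \<phi> z = 0"
      have "integral K (\<lambda>z. 2 * Re (?\<Gamma> z * \<phi> z)) = integral K (\<lambda>z. 0 :: real)"
      proof (rule integral_cong)
        fix z assume "z \<in> K"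
        then have "?\<Gamma> z = 0"
          using K(2) by (intro \<Gamma>0) blast
        then show "2 * Re (?\<Gamma> z * \<phi> z) = 0"
          by (simp only: mult_zero_left) simp
      qed
      then show "((\<lambda>t. graph_area U K (\<lambda>z. F z + of_real t * \<phi> z)) has_real_derivative 0) (at 0)"
        using variation[OF K \<phi>] by simp
    qed
  qed
qed

end

section \<open>Integration of the Euler-Lagrange equations\<close>

lemma locally_constant_derivative:
  fixes f :: "real \<Rightarrow> real"
  assumes "(f has_real_derivative d) (at x)" "open N" "x \<in> N" "\<And>y. y \<in> N \<Longrightarrow> f y = c"
  shows "d = 0"
proof -
  have "((\<lambda>_. c) has_real_derivative d) (at x)"
    by (rule has_field_derivative_transform_within_open[OF assms(1-3)]) (use assms(4) in auto)
  then show ?thesis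
    using DERIV_unique DERIV_const by blast
qed

lemma continuous_nonzero_constant_sign:
  fixes f :: "real \<Rightarrow> real"
  assumes "connected I" "continuous_on I f" "\<And>R. R \<in> I \<Longrightarrow> f R \<noteq> 0"
  obtains s :: real where "s = 1 \<or> s = -1" "\<And>R. R \<in> I \<Longrightarrow> 0 < s * f R"
proof -
  have conn: "connected (f ` I)"
    by (rule connected_continuous_image[OF assms(2,1)])
  show ?thesis
  proof (cases "\<exists>R\<in>I. 0 < f R")
    case True
    then obtain R0 where R0: "R0 \<in> I" "0 < f R0" by blast
    have "0 < f R" if "R \<in> I" for R
    proof (rule ccontr)
      assume "\<not> 0 < f R"
      then have "0 \<in> f ` I"
        using connectedD_interval[OF conn, of "f R" "f R0" 0] that R0 by auto
      then show False using assms(3) by auto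
    qed
    then show ?thesis by (intro that[of 1]) auto
  next
    case False
    then have "0 < -1 * f R" if "R \<in> I" for R
      using assms(3)[OF that] that by force
    then show ?thesis by (intro that[of "-1"]) auto
  qed
qed

context rotational_graph
begin

lemma constant_of_zero_derivative:
  fixes f :: "real \<Rightarrow> real"
  assumes "\<And>R. R \<in> I \<Longrightarrow> (f has_real_derivative 0) (at R)"
  obtains c where "\<And>R. R \<in> I \<Longrightarrow> f R = c"
  using has_field_derivative_zero_constant[of I f] assms interval_I
  by (metis has_field_derivative_at_within is_interval_convex)

lemma wpp_derivative:
  "R \<in> I \<Longrightarrow> ((\<lambda>R. w R * (p R)\<^sup>2) has_real_derivative w1 R * (p R)\<^sup>2 + 2 * w R * p R * p1 R) (at R)"
  by (auto intro!: derivative_eq_intros w_derivative p simp: algebra_simps)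

lemma inverse_w_derivative: "R \<in> I \<Longrightarrow> ((\<lambda>R. c / w R) has_real_derivative - c * w1 R / (w R)\<^sup>2) (at R)"
  using w_pos[of R] by (auto intro!: derivative_eq_intros w_derivative simp: power2_eq_square)

lemma S_eq: "S R = w1 R * (w1 R * (p R)\<^sup>2 + 2 * w R * p R * p1 R) - (w R * h1 R)\<^sup>2"
  by (simp add: S_def power2_eq_square algebra_simps)

end

context nondegenerate_rotational_graph
begin

lemma s_square: "s * s = 1"
  using s by auto

lemma S_eq_L: "R \<in> I \<Longrightarrow> S R = s * (L R)\<^sup>2"
  using L_square[of R] s_square by (simp flip: mult.assoc)

text \<open>
  Where \<open>M' \<noteq> 0\<close>, the factor \<open>p\<close> vanishes on an open set.  There \<open>s L\<^sup>2 = - (w h')\<^sup>2\<close>, so the constant \<open>\<kappa>\<close>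
  satisfies \<open>\<kappa>\<^sup>2 = - s w\<^sup>2\<close>; hence \<open>w\<close> is locally constant and \<open>M\<close> vanishes locally, contradicting \<open>M' \<noteq> 0\<close>.
\<close>

lemma M1_eq_0:
  assumes EL: "\<And>R. R \<in> I \<Longrightarrow> \<kappa>1 R = 0" "\<And>R. R \<in> I \<Longrightarrow> p R * M1 R = 0" and R0: "R0 \<in> I"
  shows "M1 R0 = 0"
proof (rule ccontr)
  assume nz: "M1 R0 \<noteq> 0"
  define N where "N = I \<inter> M1 -` (- {0})"
  have N: "open N" "R0 \<in> N" "N \<subseteq> I"
    unfolding N_def using continuous_open_preimage[OF cont_\<kappa>M\<mu>(2) open_I, of "- {0}"] nz R0 by auto
  have p0: "p R = 0" if "R \<in> N" for R
    using EL(2)[of R] that by (auto simp: N_def)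
  obtain k where k: "\<And>R. R \<in> I \<Longrightarrow> \<kappa> R = k"
    using constant_of_zero_derivative[of \<kappa>] \<kappa>_derivative EL(1) by metis
  have ww: "(w R)\<^sup>2 = - s * k\<^sup>2" if R: "R \<in> N" for R
  proof -
    have RI: "R \<in> I" using R N by auto
    have "s * (L R)\<^sup>2 = - (w R * h1 R)\<^sup>2"
      unfolding S_eq_L[OF RI, symmetric] S_eq using p0[OF R] by simp
    then have wh: "(w R * h1 R)\<^sup>2 = - s * (L R)\<^sup>2" by simp
    have "k * L R = w R * (w R * h1 R)"
      using k[OF RI] L_pos[OF RI] by (auto simp: \<kappa>_def power2_eq_square)
    then have "k\<^sup>2 * (L R)\<^sup>2 = (w R)\<^sup>2 * (- s * (L R)\<^sup>2)"
      unfolding wh[symmetric] power_mult_distrib[symmetric] by simp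
    then have "(k\<^sup>2 + s * (w R)\<^sup>2) * (L R)\<^sup>2 = 0"
      by (simp add: algebra_simps)
    then have "k\<^sup>2 = - s * (w R)\<^sup>2"
      using L_pos[OF RI] by simp
    then have "- s * k\<^sup>2 = (s * s) * (w R)\<^sup>2"
      by simp
    then show ?thesis
      by (simp add: s_square)
  qed
  have M0: "M R = 0" if R: "R \<in> N" for R
  proof -
    have RI: "R \<in> I" using R N by auto
    have "((\<lambda>R. (w R)\<^sup>2) has_real_derivative 2 * w R * w1 R) (at R)"
      by (auto intro!: derivative_eq_intros w_derivative RI)
    then have "2 * w R * w1 R = 0"
      by (rule locally_constant_derivative[OF _ N(1) R ww])
    then show ?thesis
      using w_pos[OF RI] by (simp add: M_def)
  qed
  have "M1 R0 = 0"
    by (rule locally_constant_derivative[OF M_derivative[OF R0] N(1,2) M0])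
  then show False using nz by simp
qed

text \<open>
  Both momenta are constant, \<open>\<kappa> = k\<close> and \<open>M = m \<noteq> 0\<close>, so \<open>L = w' / m\<close> can be eliminated and each of the two
  remaining equations says that the difference of two explicit functions has derivative zero.
\<close>

lemma euler_lagrange_solution:
  assumes EL: "\<And>R. R \<in> I \<Longrightarrow> \<kappa>1 R = 0" "\<And>R. R \<in> I \<Longrightarrow> p R * M1 R = 0"
    and nonconst: "\<not> w constant_on I"
  obtains A1 A2 B1 B2 \<epsilon> :: real where "A2 \<noteq> 0" "\<epsilon> = 1 \<or> \<epsilon> = -1"
    "\<And>R. R \<in> I \<Longrightarrow> h R = A1 + B1 / w R"
    "\<And>R. R \<in> I \<Longrightarrow> (p R)\<^sup>2 = A2 + B2 / w R - B1\<^sup>2 / (w R)\<^sup>2"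
    "\<And>R. R \<in> I \<Longrightarrow> 0 < \<epsilon> * p R"
proof -
  obtain k where k: "\<And>R. R \<in> I \<Longrightarrow> \<kappa> R = k"
    using constant_of_zero_derivative[of \<kappa>] \<kappa>_derivative EL(1) by metis
  obtain m where m: "\<And>R. R \<in> I \<Longrightarrow> M R = m"
    using constant_of_zero_derivative[of M] M_derivative M1_eq_0[OF EL] by metis
  have w1: "w1 R = m * L R" if "R \<in> I" for R
    using m[OF that] L_pos[OF that] by (auto simp: M_def)
  have m0: "m \<noteq> 0"
  proof
    assume "m = 0"
    then have "(w has_real_derivative 0) (at R)" if "R \<in> I" for R
      using w_derivative[OF that] w1[OF that] by simp
    then show False
      using constant_of_zero_derivative[of w] nonconst unfolding constant_on_def by metis
  qed
  have w1_nz: "w1 R \<noteq> 0" if "R \<in> I" for R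
    using w1[OF that] m0 L_pos[OF that] by simp
  define A2 where "A2 = s / m\<^sup>2"
  define B1 where "B1 = - k / m"
  have A2: "A2 \<noteq> 0"
    using m0 s by (auto simp: A2_def)
  have S: "S R = A2 * (w1 R)\<^sup>2" if "R \<in> I" for R
    using m0 by (simp add: S_eq_L[OF that] w1[OF that] A2_def power_mult_distrib)
  have h1: "h1 R = - B1 * w1 R / (w R)\<^sup>2" if "R \<in> I" for R
    using k[OF that] L_pos[OF that] w_pos[OF that] m0
    by (auto simp: \<kappa>_def B1_def w1[OF that])
  have "((\<lambda>R. h R - B1 / w R) has_real_derivative 0) (at R)" if "R \<in> I" for R
    using DERIV_diff[OF h(1)[OF that] inverse_w_derivative[OF that, of B1]] by (simp add: h1[OF that])
  then obtain A1 where A1: "\<And>R. R \<in> I \<Longrightarrow> h R - B1 / w R = A1"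
    using constant_of_zero_derivative by blast
  have Y: "w1 R * (p R)\<^sup>2 + 2 * w R * p R * p1 R = A2 * w1 R + B1\<^sup>2 * w1 R / (w R)\<^sup>2" if R: "R \<in> I" for R
  proof -
    have "w1 R * (w1 R * (p R)\<^sup>2 + 2 * w R * p R * p1 R) = A2 * (w1 R)\<^sup>2 + (w R * h1 R)\<^sup>2"
      using S_eq[of R] S[OF R] by simp
    also have "\<dots> = w1 R * (A2 * w1 R + B1\<^sup>2 * w1 R / (w R)\<^sup>2)"
      using w_pos[OF R] by (simp add: h1[OF R] field_simps power2_eq_square)
    finally show ?thesis
      using w1_nz[OF R] by simp
  qed
  have "((\<lambda>R. w R * (p R)\<^sup>2 - A2 * w R + B1\<^sup>2 / w R) has_real_derivative 0) (at R)" if R: "R \<in> I" for R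
    using DERIV_add[OF DERIV_diff[OF wpp_derivative[OF R] DERIV_cmult[OF w_derivative[OF R], of A2]]
        inverse_w_derivative[OF R, of "B1\<^sup>2"]] by (simp add: Y[OF R])
  then obtain B2 where B2: "\<And>R. R \<in> I \<Longrightarrow> w R * (p R)\<^sup>2 - A2 * w R + B1\<^sup>2 / w R = B2"
    using constant_of_zero_derivative by blast
  have pp: "(p R)\<^sup>2 = A2 + B2 / w R - B1\<^sup>2 / (w R)\<^sup>2" if "R \<in> I" for R
    using w_pos[OF that] by (simp add: B2[OF that, symmetric] field_simps power2_eq_square)
  \<comment> \<open>at a zero of p both p^2 and its derivative vanish, which determines A2 and B2 in terms of B1\<close>
  have "p R0 \<noteq> 0" if R0: "R0 \<in> I" for R0
  proof
    assume p0: "p R0 = 0"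
    have w0: "0 < w R0" by (rule w_pos[OF R0])
    have "w1 R0 * (A2 + B1\<^sup>2 / (w R0)\<^sup>2) = 0"
      using Y[OF R0] p0 by (simp add: algebra_simps)
    then have A2_eq: "A2 = - B1\<^sup>2 / (w R0)\<^sup>2"
      using w1_nz[OF R0] by simp
    have B2_eq: "B2 = 2 * B1\<^sup>2 / w R0"
      using B2[OF R0] p0 w0 by (simp add: A2_eq power2_eq_square)
    have "w R = w R0" if R: "R \<in> I" for R
    proof -
      have "(p R)\<^sup>2 = - (B1 * (1 / w R - 1 / w R0))\<^sup>2"
        unfolding pp[OF R] A2_eq B2_eq using w0 w_pos[OF R] by (simp add: field_simps power2_eq_square)
      then have "(B1 * (1 / w R - 1 / w R0))\<^sup>2 = 0"
        using zero_le_power2[of "p R"] zero_le_power2[of "B1 * (1 / w R - 1 / w R0)"] by linarith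
      then show ?thesis
        using A2 w0 w_pos[OF R] by (auto simp: A2_eq)
    qed
    then show False
      using nonconst unfolding constant_on_def by blast
  qed
  then obtain \<epsilon> where "\<epsilon> = 1 \<or> \<epsilon> = -1" "\<And>R. R \<in> I \<Longrightarrow> 0 < \<epsilon> * p R"
    using continuous_nonzero_constant_sign[OF is_interval_connected[OF interval_I] cont_hp(3)] by blast
  then show ?thesis
    using A1 by (intro that[of A2 \<epsilon> A1 B1 B2] A2 pp) (auto simp: algebra_simps)
qed

text \<open>
  The formulas give \<open>S = A\<^sub>2 w'\<^sup>2\<close>, so \<open>M\<^sup>2 = 1 / (s A\<^sub>2)\<close> is constant, and \<open>\<kappa> = - B\<^sub>1 M\<close>.  Working with \<open>M\<^sup>2\<close>
  avoids a discussion of the sign of \<open>w'\<close>.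
\<close>

lemma solution_euler_lagrange:
  assumes h_eq: "\<And>R. R \<in> I \<Longrightarrow> h R = A1 + B1 / w R"
    and p_eq: "\<And>R. R \<in> I \<Longrightarrow> (p R)\<^sup>2 = A2 + B2 / w R - B1\<^sup>2 / (w R)\<^sup>2"
    and R: "R \<in> I"
  shows "\<kappa>1 R = 0" "M1 R = 0"
proof -
  have h1: "h1 R = - B1 * w1 R / (w R)\<^sup>2" if R: "R \<in> I" for R
  proof -
    have "((\<lambda>R. A1 + B1 / w R) has_real_derivative h1 R) (at R)"
      by (rule has_field_derivative_transform_within_open[OF h(1)[OF R] open_I R h_eq])
    from DERIV_unique[OF this DERIV_add[OF DERIV_const inverse_w_derivative[OF R]]] show ?thesis
      by simp
  qed
  have Y: "w1 R * (p R)\<^sup>2 + 2 * w R * p R * p1 R = A2 * w1 R + B1\<^sup>2 * w1 R / (w R)\<^sup>2" if R: "R \<in> I" for R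
  proof -
    have eq: "w R * (p R)\<^sup>2 = A2 * w R + (B2 - B1\<^sup>2 / w R)" if "R \<in> I" for R
      unfolding p_eq[OF that] using w_pos[OF that] by (simp add: field_simps power2_eq_square)
    have 1: "((\<lambda>R. A2 * w R + (B2 - B1\<^sup>2 / w R)) has_real_derivative w1 R * (p R)\<^sup>2 + 2 * w R * p R * p1 R) (at R)"
      by (rule has_field_derivative_transform_within_open[OF wpp_derivative[OF R] open_I R eq])
    have 2: "((\<lambda>R. A2 * w R + (B2 - B1\<^sup>2 / w R)) has_real_derivative A2 * w1 R + (0 - (- B1\<^sup>2 * w1 R / (w R)\<^sup>2))) (at R)"
      by (intro DERIV_add DERIV_diff DERIV_const DERIV_cmult w_derivative inverse_w_derivative R)
    show ?thesis
      using DERIV_unique[OF 1 2] by simp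
  qed
  have L2: "(L R)\<^sup>2 = s * A2 * (w1 R)\<^sup>2" if R: "R \<in> I" for R
  proof -
    have "S R = A2 * (w1 R)\<^sup>2"
      unfolding S_eq Y[OF R] h1[OF R] using w_pos[OF R] by (simp add: field_simps power2_eq_square)
    then show ?thesis
      by (simp add: L_square[OF R])
  qed
  have M2: "(M R)\<^sup>2 = inverse (s * A2)" if R: "R \<in> I" for R
  proof -
    have "(L R)\<^sup>2 \<noteq> 0" using L_pos[OF R] by simp
    then show ?thesis
      using L2[OF R] by (simp add: M_def power_divide divide_simps)
  qed
  have "((\<lambda>R. (M R)\<^sup>2) has_real_derivative 2 * M R * M1 R) (at R)"
    by (auto intro!: derivative_eq_intros M_derivative R)
  then have "2 * M R * M1 R = 0"
    by (rule locally_constant_derivative[OF _ open_I R M2])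
  moreover have "M R \<noteq> 0"
    using L2[OF R] L_pos[OF R] by (auto simp: M_def)
  ultimately show M1: "M1 R = 0" by simp
  have "\<kappa> R = - B1 * M R" if "R \<in> I" for R
    using w_pos[OF that] by (simp add: \<kappa>_def M_def h1[OF that])
  then have "((\<lambda>R. - B1 * M R) has_real_derivative \<kappa>1 R) (at R)"
    by (intro has_field_derivative_transform_within_open[OF \<kappa>_derivative[OF R] open_I R])
  from DERIV_unique[OF this DERIV_cmult[OF M_derivative[OF R]]] show "\<kappa>1 R = 0"
    using M1 by simp
qed

end

section \<open>Radial data of a smooth equivariant section\<close>

text \<open>
  Restricted to a line through the origin, a smooth map has two derivatives in the one-variable sense.
  It applies both to the conformal factor and to the section along the positive real axis.
\<close>

lemma smooth_on_along_ray:
  fixes f :: "'a::real_normed_vector \<Rightarrow> 'b::real_normed_vector"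
  assumes f: "smooth_on S f" and T: "\<And>t. t \<in> T \<Longrightarrow> t *\<^sub>R e \<in> S"
  obtains f1 f2 where
    "\<And>t. t \<in> T \<Longrightarrow> ((\<lambda>t. f (t *\<^sub>R e)) has_vector_derivative f1 t) (at t)"
    "\<And>t. t \<in> T \<Longrightarrow> (f1 has_vector_derivative f2 t) (at t)" "continuous_on T f2"
proof -
  have chain: "((\<lambda>t. g (t *\<^sub>R e)) has_vector_derivative frechet_derivative g (at (t *\<^sub>R e)) e) (at t)"
    if "g differentiable (at (t *\<^sub>R e))" for g :: "'a \<Rightarrow> 'b" and t
  proof -
    have D: "(g has_derivative frechet_derivative g (at (t *\<^sub>R e))) (at (t *\<^sub>R e))"
      using that by (simp add: frechet_derivative_works)
    have "((\<lambda>t. g (t *\<^sub>R e)) has_derivative (\<lambda>r. frechet_derivative g (at (t *\<^sub>R e)) (r *\<^sub>R e))) (at t)"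
      by (rule has_derivative_compose[where f="\<lambda>t. t *\<^sub>R e" and g=g, OF _ D])
         (auto intro!: derivative_eq_intros)
    then show ?thesis
      unfolding has_vector_derivative_def linear_scale[OF has_derivative_linear[OF D]] .
  qed
  let ?f1 = "\<lambda>z. frechet_derivative f (at z) e"
  let ?f2 = "\<lambda>z. frechet_derivative ?f1 (at z) e"
  have C2: "Ck_on (Suc (Suc 0)) S f"
    using f by (simp only: smooth_on_def)
  then have "Ck_on 0 S ?f2"
    by simp
  then have "continuous_on S ?f2" by simp
  then have "continuous_on T (\<lambda>t. ?f2 (t *\<^sub>R e))"
    by (rule continuous_on_compose2) (auto intro!: continuous_intros T)
  then show ?thesis
    using C2 T by (intro that[of "\<lambda>t. ?f1 (t *\<^sub>R e)" "\<lambda>t. ?f2 (t *\<^sub>R e)"] chain) auto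
qed

lemma divide_by_radius_derivatives:
  fixes f :: "real \<Rightarrow> real"
  assumes I: "I \<subseteq> {0<..}"
    and f: "\<And>R. R \<in> I \<Longrightarrow> (f has_real_derivative f1 R) (at R)"
      "\<And>R. R \<in> I \<Longrightarrow> (f1 has_real_derivative f2 R) (at R)" "continuous_on I f2"
  obtains g1 g2 where "\<And>R. R \<in> I \<Longrightarrow> ((\<lambda>R. f R / R) has_real_derivative g1 R) (at R)"
      "\<And>R. R \<in> I \<Longrightarrow> (g1 has_real_derivative g2 R) (at R)" "continuous_on I g2"
proof
  have nz: "R \<noteq> 0" if "R \<in> I" for R using that I by auto
  show "((\<lambda>R. f R / R) has_real_derivative f1 R / R - f R / R\<^sup>2) (at R)" if "R \<in> I" for R
    using nz[OF that] by (auto intro!: derivative_eq_intros f that simp: field_simps power2_eq_square)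
  show "((\<lambda>R. f1 R / R - f R / R\<^sup>2) has_real_derivative
      f2 R / R - 2 * f1 R / R\<^sup>2 + 2 * f R / R ^ 3) (at R)" if "R \<in> I" for R
    using nz[OF that]
    by (auto intro!: derivative_eq_intros f that simp: field_simps power2_eq_square power3_eq_cube)
  have "continuous_on I f" "continuous_on I f1"
    using f by (meson DERIV_continuous_on has_field_derivative_at_within)+
  then show "continuous_on I (\<lambda>R. f2 R / R - 2 * f1 R / R\<^sup>2 + 2 * f R / R ^ 3)"
    using nz f(3) by (intro continuous_intros) auto
qed

lemma rot_symmetric_graph_equivariant:
  assumes rot: "rot_symmetric_surface (graph_over (annulus I) F)" and z: "z \<in> annulus I"
  shows "F (z * cis C) = F z * cis C"
proof -
  have "(z, F z) \<in> graph_over (annulus I) F"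
    using z by (auto simp: graph_over_def)
  then have "(z * cis C, F z * cis C) \<in> (\<lambda>(\<xi>, \<eta>). (\<xi> * cis C, \<eta> * cis C)) ` graph_over (annulus I) F"
    by force
  also have "\<dots> = graph_over (annulus I) F"
    using rot by (auto simp: rot_symmetric_surface_def)
  finally show ?thesis
    by (auto simp: graph_over_def)
qed

text \<open>
  The induced form is \<open>- 2 e\<^sup>2\<^sup>U Im ((\<sigma> v + i \<lambda> v\<^sup>*) w)\<close>, so its kernel is that of the real-linear map
  \<open>v \<mapsto> \<sigma> v + i \<lambda> v\<^sup>*\<close>.  Composed with its adjugate \<open>y \<mapsto> \<sigma>\<^sup>* y - i \<lambda> y\<^sup>*\<close> this map is multiplication by
  \<open>\<bar>\<sigma>\<bar>\<^sup>2 - \<lambda>\<^sup>2\<close>; if that is zero, the range of the adjugate lies in the kernel.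
\<close>

lemma nondegenerate_discriminant:
  assumes nd: "nondegenerate_form (induced_metric U F z)"
    and d: "F differentiable (at z)" "U differentiable (at z)"
  shows "(lambda U F z)\<^sup>2 - (cmod (sigma F z))\<^sup>2 \<noteq> 0"
proof
  assume 0: "(lambda U F z)\<^sup>2 - (cmod (sigma F z))\<^sup>2 = 0"
  let ?l = "complex_of_real (lambda U F z)" and ?s = "sigma F z"
  have ls: "?l * ?l = ?s * cnj ?s"
    using 0 by (simp add: complex_norm_square[symmetric] power2_eq_square[symmetric] flip: of_real_power)
  have polar: "induced_metric U F z v w = - 2 * exp (2 * U z) * Im ((?s * v + \<i> * ?l * cnj v) * w)" for v w
    unfolding induced_metric_polar[OF d] by (simp add: algebra_simps)
  have kernel: "cnj ?s * y - \<i> * ?l * cnj y = 0" for y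
  proof -
    let ?v = "cnj ?s * y - \<i> * ?l * cnj y"
    have "?s * ?v + \<i> * ?l * cnj ?v = (?s * cnj ?s - ?l * ?l) * y"
      by (simp add: algebra_simps)
    then have "?s * ?v + \<i> * ?l * cnj ?v = 0"
      by (simp add: ls)
    then have "\<forall>w. induced_metric U F z ?v w = 0"
      unfolding polar by simp
    then show ?thesis
      using nd unfolding nondegenerate_form_def by blast
  qed
  have "?l = 0 \<and> ?s = 0"
    using kernel[of 1] kernel[of \<i>] by (auto simp: complex_eq_iff)
  then have "\<forall>w. induced_metric U F z 1 w = 0"
    unfolding polar by simp
  then have "(1::complex) = 0"
    using nd unfolding nondegenerate_form_def by blast
  then show False by simp
qed

context rotational_graph
begin

lemma F_polar: "R \<in> I \<Longrightarrow> F (of_real R * cis \<theta>) = of_real R * cis \<theta> * Complex (h R) (p R)"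
  using pos_I by (subst F_eq) (auto simp: annulus_def norm_mult)

lemma polar_form_iff:
  assumes R: "R \<in> I"
  shows "(\<forall>\<theta>. F (of_real R * cis \<theta>) = (of_real a + of_real \<epsilon> * \<i> * of_real b) * cis \<theta>)
    \<longleftrightarrow> R * h R = a \<and> R * p R = \<epsilon> * b"
proof -
  have "F (of_real R * cis \<theta>) = (of_real a + of_real \<epsilon> * \<i> * of_real b) * cis \<theta>
      \<longleftrightarrow> of_real R * Complex (h R) (p R) = of_real a + of_real \<epsilon> * \<i> * of_real b" for \<theta>
    unfolding F_polar[OF R] using cis_neq_zero[of \<theta>] by (auto simp: mult.assoc mult.left_commute[of _ "cis \<theta>"] mult.commute[of _ "cis \<theta>"])
  then show ?thesis
    by (simp add: complex_eq_iff)
qed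

text \<open>
  The bracket under the root is \<open>R\<^sup>2 (A\<^sub>2 + B\<^sub>2 / w - B\<^sub>1\<^sup>2 / w\<^sup>2)\<close>, because \<open>e\<^sup>-\<^sup>2\<^sup>u = R\<^sup>2 / w\<close>.
\<close>

lemma normal_form_iff:
  assumes \<epsilon>: "\<epsilon> = 1 \<or> \<epsilon> = -1" and R: "R \<in> I"
  shows "0 \<le> A2 * R\<^sup>2 + B2 * exp (- 2 * u R) - B1\<^sup>2 / R\<^sup>2 * exp (- 4 * u R) \<and>
      (\<forall>\<theta>. F (of_real R * cis \<theta>) =
          (of_real (A1 * R + B1 / R * exp (- 2 * u R))
            + of_real \<epsilon> * \<i> * of_real (sqrt (A2 * R\<^sup>2 + B2 * exp (- 2 * u R)
                                          - B1\<^sup>2 / R\<^sup>2 * exp (- 4 * u R)))) * cis \<theta>)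
    \<longleftrightarrow> h R = A1 + B1 / w R \<and> (p R)\<^sup>2 = A2 + B2 / w R - B1\<^sup>2 / (w R)\<^sup>2 \<and> 0 \<le> \<epsilon> * p R"
proof -
  define \<Psi> where "\<Psi> = A2 * R\<^sup>2 + B2 * exp (- 2 * u R) - B1\<^sup>2 / R\<^sup>2 * exp (- 4 * u R)"
  define Q where "Q = A2 + B2 / w R - B1\<^sup>2 / (w R)\<^sup>2"
  have R0: "0 < R" using R pos_I by auto
  have e2: "exp (- 2 * u R) = R\<^sup>2 / w R"
    using R0 by (simp add: w_def exp_minus field_simps)
  have "exp (- 4 * u R) = exp (- 2 * u R) * exp (- 2 * u R)"
    by (simp flip: exp_add)
  then have e4: "exp (- 4 * u R) = R ^ 4 / (w R)\<^sup>2"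
    unfolding e2 by (simp add: power2_eq_square power4_eq_xxxx)
  have \<Psi>Q: "\<Psi> = R\<^sup>2 * Q"
    using R0 w_pos[OF R] unfolding \<Psi>_def Q_def e2 e4
    by (simp add: field_simps power2_eq_square power4_eq_xxxx)
  have a: "R * h R = A1 * R + B1 / R * exp (- 2 * u R) \<longleftrightarrow> h R = A1 + B1 / w R"
  proof -
    have "A1 * R + B1 / R * exp (- 2 * u R) = R * (A1 + B1 / w R)"
      using R0 unfolding e2 by (simp add: field_simps power2_eq_square)
    then show ?thesis using R0 by simp
  qed
  have b: "0 \<le> \<Psi> \<and> R * p R = \<epsilon> * sqrt \<Psi> \<longleftrightarrow> (p R)\<^sup>2 = Q \<and> 0 \<le> \<epsilon> * p R"
  proof -
    have "sqrt \<Psi> = R * sqrt Q"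
      using R0 by (simp add: \<Psi>Q real_sqrt_mult)
    then have "0 \<le> \<Psi> \<and> R * p R = \<epsilon> * sqrt \<Psi> \<longleftrightarrow> 0 \<le> Q \<and> p R = \<epsilon> * sqrt Q"
      using R0 by (auto simp: \<Psi>Q zero_le_mult_iff)
    also have "\<dots> \<longleftrightarrow> 0 \<le> Q \<and> \<epsilon> * p R = sqrt Q"
      using \<epsilon> by auto
    also have "\<dots> \<longleftrightarrow> (p R)\<^sup>2 = Q \<and> 0 \<le> \<epsilon> * p R"
    proof -
      have "(\<epsilon> * p R)\<^sup>2 = (p R)\<^sup>2"
        using \<epsilon> by auto
      then show ?thesis
        by (metis real_sqrt_ge_zero real_sqrt_pow2 real_sqrt_unique zero_le_power2)
    qed
    finally show ?thesis .
  qed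
  show ?thesis
    unfolding \<Psi>_def[symmetric] Q_def[symmetric] polar_form_iff[OF R] a using b by blast
qed

end

theorem theorem2:
  fixes I :: "real set" and u :: "real \<Rightarrow> real" and F :: "complex \<Rightarrow> complex"
  assumes I: "open I" "is_interval I" "I \<subseteq> {0<..}"
    and u: "smooth_on I u"
    and not_cylinder: "\<not> (\<lambda>R. R\<^sup>2 * exp (2 * u R)) constant_on I"
    and F: "smooth_on (annulus I) F"
    and rot: "rot_symmetric_surface (graph_over (annulus I) F)"
    and nondeg: "\<And>\<xi>. \<xi> \<in> annulus I \<Longrightarrow> nondegenerate_form (induced_metric (\<lambda>z. u (cmod z)) F \<xi>)"
  shows "area_stationary (\<lambda>z. u (cmod z)) (annulus I) F \<longleftrightarrow>
    (\<exists>A\<^sub>1 A\<^sub>2 B\<^sub>1 B\<^sub>2 \<epsilon> :: real. A\<^sub>2 \<noteq> 0 \<and> \<epsilon> \<in> {1, -1} \<and>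
      (\<forall>R\<in>I. 0 \<le> A\<^sub>2 * R\<^sup>2 + B\<^sub>2 * exp (- 2 * u R) - B\<^sub>1\<^sup>2 / R\<^sup>2 * exp (- 4 * u R) \<and>
        (\<forall>\<theta>. F (of_real R * cis \<theta>) =
          (of_real (A\<^sub>1 * R + B\<^sub>1 / R * exp (- 2 * u R))
            + of_real \<epsilon> * \<i> * of_real (sqrt (A\<^sub>2 * R\<^sup>2 + B\<^sub>2 * exp (- 2 * u R)
                                          - B\<^sub>1\<^sup>2 / R\<^sup>2 * exp (- 4 * u R)))) * cis \<theta>)))"
proof -
  have ann: "of_real R \<in> annulus I" if "R \<in> I" for R
    using that I(3) by (auto simp: annulus_def)
  obtain u1 u2 where u12: "\<And>R. R \<in> I \<Longrightarrow> (u has_real_derivative u1 R) (at R)"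
      "\<And>R. R \<in> I \<Longrightarrow> (u1 has_real_derivative u2 R) (at R)" "continuous_on I u2"
    using smooth_on_along_ray[OF u, of I 1] by (auto simp: has_real_derivative_iff_has_vector_derivative)
  obtain G1 G2 where G12: "\<And>R. R \<in> I \<Longrightarrow> ((\<lambda>R. F (of_real R)) has_vector_derivative G1 R) (at R)"
      "\<And>R. R \<in> I \<Longrightarrow> (G1 has_vector_derivative G2 R) (at R)" "continuous_on I G2"
    using smooth_on_along_ray[OF F, of I 1] ann by (auto simp: scaleR_conv_of_real)
  have Re_G: "((\<lambda>R. Re (F (of_real R))) has_real_derivative Re (G1 R)) (at R)"
      "((\<lambda>R. Re (G1 R)) has_real_derivative Re (G2 R)) (at R)"
    and Im_G: "((\<lambda>R. Im (F (of_real R))) has_real_derivative Im (G1 R)) (at R)"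
      "((\<lambda>R. Im (G1 R)) has_real_derivative Im (G2 R)) (at R)" if "R \<in> I" for R
    using G12(1,2)[OF that] by (simp_all add: has_vector_derivative_complex_iff)
  define h where "h = (\<lambda>R. Re (F (of_real R)) / R)"
  define p where "p = (\<lambda>R. Im (F (of_real R)) / R)"
  obtain h1 h2 where h12: "\<And>R. R \<in> I \<Longrightarrow> (h has_real_derivative h1 R) (at R)"
      "\<And>R. R \<in> I \<Longrightarrow> (h1 has_real_derivative h2 R) (at R)" "continuous_on I h2"
    by (rule divide_by_radius_derivatives[OF I(3) Re_G(1,2) continuous_on_Re[OF G12(3)], folded h_def])
      (assumption | rule that)+
  obtain p1 p2 where p12: "\<And>R. R \<in> I \<Longrightarrow> (p has_real_derivative p1 R) (at R)"
      "\<And>R. R \<in> I \<Longrightarrow> (p1 has_real_derivative p2 R) (at R)" "continuous_on I p2"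
    by (rule divide_by_radius_derivatives[OF I(3) Im_G(1,2) continuous_on_Im[OF G12(3)], folded p_def])
      (assumption | rule that)+
  have F_eq: "F z = z * Complex (h (cmod z)) (p (cmod z))" if z: "z \<in> annulus I" for z
  proof -
    define R where "R = cmod z"
    have R: "R \<in> I" "0 < R" using z I(3) by (auto simp: annulus_def R_def)
    have z_eq: "of_real R * cis (Arg z) = z"
      unfolding R_def by (metis rcis_cmod_Arg rcis_def)
    have "F z = F (of_real R) * cis (Arg z)"
      using rot_symmetric_graph_equivariant[OF rot ann[OF R(1)], of "Arg z"] by (simp only: z_eq)
    also have "F (of_real R) = of_real R * Complex (h R) (p R)"
      using R(2) by (simp add: h_def p_def complex_eq_iff)
    finally show ?thesis
      using z_eq by (simp add: R_def[symmetric] mult_ac)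
  qed
  interpret rotational_graph I u u1 u2 h h1 h2 p p1 p2 F
    by unfold_locales (fact I u12 h12 p12 F_eq)+
  have F1: "Ck_on 1 (annulus I) F"
    using F by (simp only: smooth_on_def)
  have U1: "Ck_on 1 (annulus I) U"
    by (rule C1_on_radial[OF pos_I _ cont_u(2)]) (use u12 in \<open>simp add: has_real_derivative_iff_has_vector_derivative\<close>)
  have S_nz: "S R \<noteq> 0" if R: "R \<in> I" for R
    using nondegenerate_discriminant[OF nondeg[OF ann[OF R]] differentiable_of_C1_on[OF F1 ann[OF R]]
        differentiable_of_C1_on[OF U1 ann[OF R]]] R I(3)
    unfolding discriminant_F[OF ann[OF R]] by auto
  obtain s where s: "s = 1 \<or> s = -1" "\<And>R. R \<in> I \<Longrightarrow> 0 < s * S R"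
    using continuous_nonzero_constant_sign[OF is_interval_connected[OF I(2)] cont_S(1) S_nz] by blast
  interpret nondegenerate_rotational_graph I u u1 u2 h h1 h2 p p1 p2 F s
    by unfold_locales (fact s)+
  have nonconst: "\<not> w constant_on I"
    using not_cylinder by (simp add: w_def[abs_def])
  have "area_stationary U (annulus I) F \<longleftrightarrow>
    (\<exists>A\<^sub>1 A\<^sub>2 B\<^sub>1 B\<^sub>2 \<epsilon> :: real. A\<^sub>2 \<noteq> 0 \<and> (\<epsilon> = 1 \<or> \<epsilon> = -1) \<and>
      (\<forall>R\<in>I. h R = A\<^sub>1 + B\<^sub>1 / w R \<and> (p R)\<^sup>2 = A\<^sub>2 + B\<^sub>2 / w R - B\<^sub>1\<^sup>2 / (w R)\<^sup>2 \<and> 0 \<le> \<epsilon> * p R))"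
    unfolding area_stationary_iff[OF F1]
  proof
    assume "\<forall>R\<in>I. \<kappa>1 R = 0 \<and> p R * M1 R = 0"
    then have EL: "\<And>R. R \<in> I \<Longrightarrow> \<kappa>1 R = 0" "\<And>R. R \<in> I \<Longrightarrow> p R * M1 R = 0"
      by blast+
    obtain A1 A2 B1 B2 \<epsilon> :: real where "A2 \<noteq> 0" "\<epsilon> = 1 \<or> \<epsilon> = -1"
      "\<And>R. R \<in> I \<Longrightarrow> h R = A1 + B1 / w R"
      "\<And>R. R \<in> I \<Longrightarrow> (p R)\<^sup>2 = A2 + B2 / w R - B1\<^sup>2 / (w R)\<^sup>2"
      "\<And>R. R \<in> I \<Longrightarrow> 0 < \<epsilon> * p R"
      by (rule euler_lagrange_solution[OF EL nonconst]) (assumption | rule that)+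
    then show "\<exists>A\<^sub>1 A\<^sub>2 B\<^sub>1 B\<^sub>2 \<epsilon> :: real. A\<^sub>2 \<noteq> 0 \<and> (\<epsilon> = 1 \<or> \<epsilon> = -1) \<and>
      (\<forall>R\<in>I. h R = A\<^sub>1 + B\<^sub>1 / w R \<and> (p R)\<^sup>2 = A\<^sub>2 + B\<^sub>2 / w R - B\<^sub>1\<^sup>2 / (w R)\<^sup>2 \<and> 0 \<le> \<epsilon> * p R)"
      by (intro exI[of _ A1] exI[of _ A2] exI[of _ B1] exI[of _ B2] exI[of _ \<epsilon>] conjI ballI less_imp_le)
  next
    assume "\<exists>A\<^sub>1 A\<^sub>2 B\<^sub>1 B\<^sub>2 \<epsilon> :: real. A\<^sub>2 \<noteq> 0 \<and> (\<epsilon> = 1 \<or> \<epsilon> = -1) \<and>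
      (\<forall>R\<in>I. h R = A\<^sub>1 + B\<^sub>1 / w R \<and> (p R)\<^sup>2 = A\<^sub>2 + B\<^sub>2 / w R - B\<^sub>1\<^sup>2 / (w R)\<^sup>2 \<and> 0 \<le> \<epsilon> * p R)"
    then obtain A1 A2 B1 B2 :: real where "\<And>R. R \<in> I \<Longrightarrow> h R = A1 + B1 / w R"
      "\<And>R. R \<in> I \<Longrightarrow> (p R)\<^sup>2 = A2 + B2 / w R - B1\<^sup>2 / (w R)\<^sup>2"
      by blast
    then show "\<forall>R\<in>I. \<kappa>1 R = 0 \<and> p R * M1 R = 0"
      using solution_euler_lagrange by simp
  qed
  also have "\<dots> \<longleftrightarrow> (\<exists>A\<^sub>1 A\<^sub>2 B\<^sub>1 B\<^sub>2 \<epsilon> :: real. A\<^sub>2 \<noteq> 0 \<and> \<epsilon> \<in> {1, -1} \<and>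
      (\<forall>R\<in>I. 0 \<le> A\<^sub>2 * R\<^sup>2 + B\<^sub>2 * exp (- 2 * u R) - B\<^sub>1\<^sup>2 / R\<^sup>2 * exp (- 4 * u R) \<and>
        (\<forall>\<theta>. F (of_real R * cis \<theta>) =
          (of_real (A\<^sub>1 * R + B\<^sub>1 / R * exp (- 2 * u R))
            + of_real \<epsilon> * \<i> * of_real (sqrt (A\<^sub>2 * R\<^sup>2 + B\<^sub>2 * exp (- 2 * u R)
                                          - B\<^sub>1\<^sup>2 / R\<^sup>2 * exp (- 4 * u R)))) * cis \<theta>)))"
    unfolding insert_iff empty_iff simp_thms
    by (intro ex_cong1 conj_cong refl ball_cong normal_form_iff[symmetric])
  finally show ?thesis .
qed

end
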